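(* Let $\mu$ be the vector of market weights and $A\in CBV([0,T],\mathbb{R}^m)$. Let $G:\mathbb{R}^d\times\mathbb{R}^m\to(0,\infty)$ be regular for the pair $(\mu,A)$, normalized so that $G(\mu(0),A(0))=1$, and suppose that: (i) there is a function $F$ of $(\mu(t),A(t))$ such that $G(\mu(t),A(t))\ge F(\mu(t),A(t))>0$ for all $t\in[0,T]$ and the mapping $t\mapsto F(\mu(t),A(t))$ is nondecreasing on $[0,T]$; (ii) $\Gamma^G(\cdot)$ is nonincreasing on $[0,T]$, and there is a positive constant $\kappa$ with $\Gamma^G(t)\ge-\kappa$ for all $t\in[0,T]$. Suppose that for some real number $T_*\in(0,T]$ $$\log F(\mu(T_* ),A(T_* ))>\frac{\kappa}{F(\mu(0),A(0))}.$$ Then the trading strategy $\psi$ multiplicatively generated by $G$ is strong arbitrage relative to the market over every time horizon $[0,t]$ with $T_*\le t\le T$.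
   Context: Partitions: $T>0$ is fixed, and $(\mathbb{T}_n)_{n\in\mathbb{N}}$ is a fixed sequence of finite partitions of $[0,T]$ (containing $0$ and $T$) with $\mathbb{T}_1\subset\mathbb{T}_2\subset\cdots$ and mesh tending to $0$. $[t_j,t_{j+1}]\in\mathbb{T}_n$ means that $t_j<t_{j+1}$ are consecutive points of $\mathbb{T}_n$; in sums over $[t_j,t_{j+1}]\in\mathbb{T}_n$ with $t_j\le t$, $t_{j+1}$ is replaced by $t$ when $j$ is the largest index with $t_j\le t$. Market weights: $S_1,\dots,S_d:[0,T]\to[0,\infty)$ ($d\ge2$) are continuous with $S_i(0)>0$ and $S_1(t)+\dots+S_d(t)>0$ for all $t$; $\mu_i(t)=S_i(t)/(S_1(t)+\dots+S_d(t))$. It is assumed that $\mu$ has pathwise quadratic covariations along $(\mathbb{T}_n)$: for all $i,k$ and $t$ the limit $\langle\mu_i,\mu_k\rangle(t)=\lim_n\sum_{[t_j,t_{j+1}]\in\mathbb{T}_n,\,t_j\le t}(\mu_i(t_{j+1})-\mu_i(t_j))(\mu_k(t_{j+1})-\mu_k(t_j))$ exists and is real-valued and continuous in $t$. $CBV([0,T],\mathbb{R}^m)$: continuous $\mathbb{R}^m$-valued functions of bounded variation on $[0,T]$. $\mathbb{C}^{2,1}$: functions on $\mathbb{R}^{d+m}$ twice continuously differentiable in the first $d$ variables and once continuously differentiable in the last $m$ variables; $\partial_i$ denotes the derivative in the $i$-th of the first $d$ variables. Integral: for integrands $\theta=(\theta_1,\dots,\theta_d)$ below, $\int_0^t\sum_{i=1}^d\theta_i(s)\,d\mu_i(s):=\lim_{n}\sum_{[t_j,t_{j+1}]\in\mathbb{T}_n,\,t_j\le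 t}\sum_{i=1}^d\theta_i(t_j)(\mu_i(t_{j+1})-\mu_i(t_j))$ (the limits needed here exist by the pathwise Itô formula). Regular function: $G\in\mathbb{C}^{2,1}$ is regular for $(\mu,A)$ if $\Gamma^G(t):=G(\mu(0),A(0))-G(\mu(t),A(t))+\int_0^t\sum_i\partial_iG(\mu(s),A(s))\,d\mu_i(s)$, $0\le t\le T$, has finite variation on compact intervals of $[0,T]$. Multiplicative generation: put $\eta_i(t)=\partial_iG(\mu(t),A(t))\exp\big(\int_0^t\frac{d\Gamma^G(s)}{G(\mu(s),A(s))}\big)$ (Lebesgue–Stieltjes integral in the exponent), $V^\eta(t)=\sum_i\eta_i(t)\mu_i(t)$, $Q^\eta(t)=V^\eta(t)-V^\eta(0)-\int_0^t\sum_i\eta_i(s)\,d\mu_i(s)$, and $C(0)=\sum_i\partial_iG(\mu(0),A(0))\mu_i(0)-G(\mu(0),A(0))$. The trading strategy multiplicatively generated by $G$ is $\psi_i(t)=\eta_i(t)-Q^\eta(t)-C(0)$, $i=1,\dots,d$; its value is $V^\psi(t)=\sum_i\psi_i(t)\mu_i(t)$. Strong relative arbitrage: a trading strategy $\psi$ is strong arbitrage relative to the market over $[0,t]$, $t\in(0,T]$, if $V^\psi(s)\ge0$ for all $s\in[0,t]$ and $V^\psi(t)>V^\psi(0)$. *)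

theory Defs
  imports "HOL-Analysis.Analysis"
begin

section \<open>Partitions\<close>

definition consecutive :: "real set \<Rightarrow> (real \<times> real) set" where
  "consecutive P = {(s, u). s \<in> P \<and> u \<in> P \<and> s < u \<and> P \<inter> {s<..<u} = {}}"

definition mesh :: "real set \<Rightarrow> real" where
  "mesh P = Max ((\<lambda>(s, u). u - s) ` consecutive P)"

definition refining_partitions :: "real \<Rightarrow> (nat \<Rightarrow> real set) \<Rightarrow> bool" where
  "refining_partitions T \<pi> \<longleftrightarrow>
     (\<forall>n. finite (\<pi> n) \<and> \<pi> n \<subseteq> {0..T} \<and> 0 \<in> \<pi> n \<and> T \<in> \<pi> n) \<and>
     (\<forall>n. \<pi> n \<subseteq> \<pi> (Suc n)) \<and>
     (\<lambda>n. mesh (\<pi> n)) \<longlonglongrightarrow> 0"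


section \<open>Bounded variation and Lebesgue--Stieltjes integrals\<close>

definition variation_sums :: "(real \<Rightarrow> 'a::real_normed_vector) \<Rightarrow> real \<Rightarrow> real \<Rightarrow> real set" where
  "variation_sums g a b =
     {(\<Sum>(s, u)\<in>consecutive P. norm (g u - g s)) | P. finite P \<and> P \<subseteq> {a..b}}"

definition bounded_variation_on :: "(real \<Rightarrow> 'a::real_normed_vector) \<Rightarrow> real \<Rightarrow> real \<Rightarrow> bool" where
  "bounded_variation_on g a b \<longleftrightarrow> bdd_above (variation_sums g a b)"

definition total_variation :: "(real \<Rightarrow> 'a::real_normed_vector) \<Rightarrow> real \<Rightarrow> real \<Rightarrow> real" where
  "total_variation g a b = Sup (variation_sums g a b)"

definition CBV :: "real \<Rightarrow> (real \<Rightarrow> 'a::real_normed_vector) \<Rightarrow> bool" where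
  "CBV T g \<longleftrightarrow> continuous_on {0..T} g \<and> bounded_variation_on g 0 T"

definition positive_variation :: "(real \<Rightarrow> real) \<Rightarrow> real \<Rightarrow> real \<Rightarrow> real" where
  "positive_variation g a t = (total_variation g a t + (g t - g a)) / 2"

definition negative_variation :: "(real \<Rightarrow> real) \<Rightarrow> real \<Rightarrow> real \<Rightarrow> real" where
  "negative_variation g a t = (total_variation g a t - (g t - g a)) / 2"

text \<open>
  The signed measure of a continuous \<open>g\<close> of bounded variation is the difference of the measures
  of the two nondecreasing functions in its Jordan decomposition. Since \<^const>\<open>interval_measure\<close>
  expects a function on the whole line, these are extended by constants outside \<open>[a, b]\<close>.
\<close>

definition LS_integral :: "(real \<Rightarrow> real) \<Rightarrow> (real \<Rightarrow> real) \<Rightarrow> real \<Rightarrow> real \<Rightarrow> real" where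
  "LS_integral f g a b =
     (LINT s:{a<..b}|interval_measure (\<lambda>r. positive_variation g a (max a (min b r))). f s) -
     (LINT s:{a<..b}|interval_measure (\<lambda>r. negative_variation g a (max a (min b r))). f s)"


section \<open>Functions of class \<open>C\<^sup>2\<^sup>,\<^sup>1\<close>\<close>

definition pd_fst :: "'d \<Rightarrow> ((real^'d) \<times> 'b \<Rightarrow> real) \<Rightarrow> (real^'d) \<times> 'b \<Rightarrow> real" where
  "pd_fst i G z = deriv (\<lambda>h. G (fst z + h *\<^sub>R axis i 1, snd z)) 0"

definition pd_snd :: "'m \<Rightarrow> ('a \<times> (real^'m) \<Rightarrow> real) \<Rightarrow> 'a \<times> (real^'m) \<Rightarrow> real" where
  "pd_snd l G z = deriv (\<lambda>h. G (fst z, snd z + h *\<^sub>R axis l 1)) 0"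

definition C1_fst :: "((real^'d) \<times> 'b::topological_space \<Rightarrow> real) \<Rightarrow> bool" where
  "C1_fst G \<longleftrightarrow>
     (\<forall>i. (\<forall>z. (\<lambda>h. G (fst z + h *\<^sub>R axis i 1, snd z)) field_differentiable (at 0)) \<and>
          continuous_on UNIV (pd_fst i G))"

definition C1_snd :: "('a::topological_space \<times> (real^'m) \<Rightarrow> real) \<Rightarrow> bool" where
  "C1_snd G \<longleftrightarrow>
     (\<forall>l. (\<forall>z. (\<lambda>h. G (fst z, snd z + h *\<^sub>R axis l 1)) field_differentiable (at 0)) \<and>
          continuous_on UNIV (pd_snd l G))"

definition C21 :: "((real^'d) \<times> (real^'m) \<Rightarrow> real) \<Rightarrow> bool" where
  "C21 G \<longleftrightarrow> C1_fst G \<and> (\<forall>i. C1_fst (pd_fst i G)) \<and> C1_snd G"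

definition grad_fst :: "((real^'d) \<times> 'b \<Rightarrow> real) \<Rightarrow> (real^'d) \<times> 'b \<Rightarrow> real^'d" where
  "grad_fst G z = (\<chi> i. pd_fst i G z)"


section \<open>Market weights and pathwise integrals\<close>

definition market_prices :: "real \<Rightarrow> (real \<Rightarrow> real^'d) \<Rightarrow> bool" where
  "market_prices T S \<longleftrightarrow>
     continuous_on {0..T} S \<and>
     (\<forall>t\<in>{0..T}. \<forall>i. 0 \<le> S t $ i) \<and>
     (\<forall>i. 0 < S 0 $ i) \<and>
     (\<forall>t\<in>{0..T}. 0 < (\<Sum>i\<in>UNIV. S t $ i))"

definition market_weights :: "(real \<Rightarrow> real^'d) \<Rightarrow> real \<Rightarrow> real^'d" where
  "market_weights S t = (\<chi> i. S t $ i / (\<Sum>k\<in>UNIV. S t $ k))"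

text \<open>
  In sums up to time \<open>t\<close>, only the last interval \<open>[s, u]\<close> with \<open>s \<le> t\<close> can have \<open>t < u\<close>;
  \<open>min u t\<close> thus replaces its right endpoint by \<open>t\<close> and leaves all others unchanged.
\<close>

definition covariation_sum ::
  "real set \<Rightarrow> (real \<Rightarrow> real^'d) \<Rightarrow> 'd \<Rightarrow> 'd \<Rightarrow> real \<Rightarrow> real" where
  "covariation_sum P \<mu> i k t =
     (\<Sum>(s, u)\<in>{(s, u)\<in>consecutive P. s \<le> t}.
        (\<mu> (min u t) $ i - \<mu> s $ i) * (\<mu> (min u t) $ k - \<mu> s $ k))"

definition has_covariations :: "real \<Rightarrow> (nat \<Rightarrow> real set) \<Rightarrow> (real \<Rightarrow> real^'d) \<Rightarrow> bool" where
  "has_covariations T \<pi> \<mu> \<longleftrightarrow>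
     (\<forall>i k. (\<forall>t\<in>{0..T}. convergent (\<lambda>n. covariation_sum (\<pi> n) \<mu> i k t)) \<and>
            continuous_on {0..T} (\<lambda>t. lim (\<lambda>n. covariation_sum (\<pi> n) \<mu> i k t)))"

definition pathwise_integral ::
  "(nat \<Rightarrow> real set) \<Rightarrow> (real \<Rightarrow> real^'d) \<Rightarrow> (real \<Rightarrow> real^'d) \<Rightarrow> real \<Rightarrow> real" where
  "pathwise_integral \<pi> \<theta> \<mu> t =
     lim (\<lambda>n. \<Sum>(s, u)\<in>{(s, u)\<in>consecutive (\<pi> n). s \<le> t}.
                \<Sum>i\<in>UNIV. \<theta> s $ i * (\<mu> (min u t) $ i - \<mu> s $ i))"


section \<open>Regular functions and multiplicative generation\<close>

definition Gam ::
  "(nat \<Rightarrow> real set) \<Rightarrow> ((real^'d) \<times> (real^'m) \<Rightarrow> real) \<Rightarrow>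
   (real \<Rightarrow> real^'d) \<Rightarrow> (real \<Rightarrow> real^'m) \<Rightarrow> real \<Rightarrow> real" where
  "Gam \<pi> G \<mu> A t =
     G (\<mu> 0, A 0) - G (\<mu> t, A t) + pathwise_integral \<pi> (\<lambda>s. grad_fst G (\<mu> s, A s)) \<mu> t"

definition regular_for ::
  "real \<Rightarrow> (nat \<Rightarrow> real set) \<Rightarrow> ((real^'d) \<times> (real^'m) \<Rightarrow> real) \<Rightarrow>
   (real \<Rightarrow> real^'d) \<Rightarrow> (real \<Rightarrow> real^'m) \<Rightarrow> bool" where
  "regular_for T \<pi> G \<mu> A \<longleftrightarrow>
     C21 G \<and> (\<forall>a b. {a..b} \<subseteq> {0..T} \<longrightarrow> bounded_variation_on (Gam \<pi> G \<mu> A) a b)"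

definition portfolio_value :: "(real \<Rightarrow> real^'d) \<Rightarrow> (real \<Rightarrow> real^'d) \<Rightarrow> real \<Rightarrow> real" where
  "portfolio_value \<theta> \<mu> t = (\<Sum>i\<in>UNIV. \<theta> t $ i * \<mu> t $ i)"

definition self_financing_defect ::
  "(nat \<Rightarrow> real set) \<Rightarrow> (real \<Rightarrow> real^'d) \<Rightarrow> (real \<Rightarrow> real^'d) \<Rightarrow> real \<Rightarrow> real" where
  "self_financing_defect \<pi> \<theta> \<mu> t =
     portfolio_value \<theta> \<mu> t - portfolio_value \<theta> \<mu> 0 - pathwise_integral \<pi> \<theta> \<mu> t"

definition mult_eta ::
  "(nat \<Rightarrow> real set) \<Rightarrow> ((real^'d) \<times> (real^'m) \<Rightarrow> real) \<Rightarrow>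
   (real \<Rightarrow> real^'d) \<Rightarrow> (real \<Rightarrow> real^'m) \<Rightarrow> real \<Rightarrow> real^'d" where
  "mult_eta \<pi> G \<mu> A t =
     (\<chi> i. pd_fst i G (\<mu> t, A t) *
           exp (LS_integral (\<lambda>s. 1 / G (\<mu> s, A s)) (Gam \<pi> G \<mu> A) 0 t))"

definition initial_defect ::
  "((real^'d) \<times> (real^'m) \<Rightarrow> real) \<Rightarrow> (real \<Rightarrow> real^'d) \<Rightarrow> (real \<Rightarrow> real^'m) \<Rightarrow> real" where
  "initial_defect G \<mu> A =
     (\<Sum>i\<in>UNIV. pd_fst i G (\<mu> 0, A 0) * \<mu> 0 $ i) - G (\<mu> 0, A 0)"

definition mult_generated ::
  "(nat \<Rightarrow> real set) \<Rightarrow> ((real^'d) \<times> (real^'m) \<Rightarrow> real) \<Rightarrow>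
   (real \<Rightarrow> real^'d) \<Rightarrow> (real \<Rightarrow> real^'m) \<Rightarrow> real \<Rightarrow> real^'d" where
  "mult_generated \<pi> G \<mu> A t =
     (\<chi> i. mult_eta \<pi> G \<mu> A t $ i -
           self_financing_defect \<pi> (mult_eta \<pi> G \<mu> A) \<mu> t - initial_defect G \<mu> A)"

definition strong_arbitrage :: "(real \<Rightarrow> real^'d) \<Rightarrow> (real \<Rightarrow> real^'d) \<Rightarrow> real \<Rightarrow> bool" where
  "strong_arbitrage \<psi> \<mu> t \<longleftrightarrow>
     (\<forall>s\<in>{0..t}. 0 \<le> portfolio_value \<psi> \<mu> s) \<and>
     portfolio_value \<psi> \<mu> 0 < portfolio_value \<psi> \<mu> t"

end

theory Submission
  imports Defs
begin

text \<open>
  The value of the multiplicatively generated strategy turns out to be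
  \<open>V(t) = G(\<mu>(t), A(t)) E(t)\<close> with \<open>E = exp (\<integral> d\<Gamma> / G)\<close>, where \<open>\<Gamma>\<close> abbreviates \<open>\<Gamma>\<^sup>G\<close>. Since \<open>\<Gamma>\<close> decreases by
  at most \<open>\<kappa>\<close> and \<open>G \<ge> F(\<mu>(0), A(0))\<close> along the path, \<open>log V(t) \<ge> log F(\<mu>(T\<^sub>*), A(T\<^sub>*)) - \<kappa> / F(\<mu>(0), A(0)) > 0\<close>
  for \<open>t \<ge> T\<^sub>*\<close>, whereas \<open>V(0) = 1\<close>.

  For the value formula, a Taylor expansion (second order in \<open>\<mu>\<close>, first order in \<open>A\<close>) of \<open>G\<close> along the
  path shows that the discrete defects \<open>\<nabla>G(s) \<cdot> (\<mu>(u) - \<mu>(s)) - (G(u) - G(s))\<close> have uniformly bounded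
  variation along the partitions and that their sums converge to \<open>\<Gamma>\<close>, which is therefore continuous.
  A Helly type argument, which freezes a continuous integrand on the cells of a coarser partition,
  transfers this convergence to sums weighted by \<open>E\<close>. Summation by parts and
  \<open>E(u) - E(s) \<approx> E(s) (\<Gamma>(u) - \<Gamma>(s)) / G(u)\<close> then give \<open>\<integral> E \<nabla>G d\<mu> = G E - 1\<close>.
\<close>

section \<open>Sums along partitions\<close>

text \<open>
  For increments with \<open>D x x = 0\<close>, taking the minimum with \<open>t\<close> in both arguments amounts to stopping
  the sum at \<open>t\<close>; this form needs no restriction on the index set.
\<close>

definition partition_sum :: "real set \<Rightarrow> (real \<Rightarrow> real \<Rightarrow> real) \<Rightarrow> real \<Rightarrow> real" where
  "partition_sum P D t = (\<Sum>(s, u)\<in>consecutive P. D (min s t) (min u t))"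

definition partition_of :: "real \<Rightarrow> real set \<Rightarrow> bool" where
  "partition_of T P \<longleftrightarrow> finite P \<and> P \<subseteq> {0..T} \<and> 0 \<in> P \<and> T \<in> P"

definition finer_than :: "real \<Rightarrow> real set \<Rightarrow> bool" where
  "finer_than \<delta> P \<longleftrightarrow> (\<forall>(s, u)\<in>consecutive P. u - s < \<delta>)"

section \<open>Elementary facts on partitions and stopped sums\<close>

lemma finite_consecutive [simp]: "finite P \<Longrightarrow> finite (consecutive P)"
  by (rule finite_subset[of _ "P \<times> P"]) (auto simp: consecutive_def)

lemma partition_ofD:
  assumes "partition_of T P"
  shows "finite P" "0 \<in> P" "T \<in> P" "x \<in> P \<Longrightarrow> 0 \<le> x" "x \<in> P \<Longrightarrow> x \<le> T" "0 \<le> T"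
  using assms by (auto simp: partition_of_def)

lemma consecutive_iff:
  "(s, u) \<in> consecutive P \<longleftrightarrow> s \<in> P \<and> u \<in> P \<and> s < u \<and> (\<forall>x\<in>P. x \<le> s \<or> u \<le> x)"
  by (auto simp: consecutive_def disjoint_iff not_less)

lemma consecutiveD:
  assumes "(s, u) \<in> consecutive P"
  shows "s \<in> P" "u \<in> P" "s < u" "x \<in> P \<Longrightarrow> x \<le> s \<or> u \<le> x"
  using assms by (auto simp: consecutive_iff)

lemma partition_sum_alt:
  assumes "finite P" and "\<And>x. D x x = 0"
  shows "(\<Sum>(s, u)\<in>{(s, u)\<in>consecutive P. s \<le> t}. D s (min u t)) = partition_sum P D t"
  unfolding partition_sum_def
  by (rule sum.mono_neutral_cong_left) (use assms in \<open>auto simp: min_def split: if_splits dest: consecutiveD(3)\<close>)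

lemma partition_sum_cong:
  assumes "\<And>s u. (s, u) \<in> consecutive P \<Longrightarrow> D (min s t) (min u t) = D' (min s t) (min u t)"
  shows "partition_sum P D t = partition_sum P D' t"
  unfolding partition_sum_def by (rule sum.cong) (auto simp: assms)

lemma partition_sum_add:
  "partition_sum P (\<lambda>s u. D s u + D' s u) t = partition_sum P D t + partition_sum P D' t"
  by (simp add: partition_sum_def sum.distrib case_prod_beta)

lemma partition_sum_diff:
  "partition_sum P (\<lambda>s u. D s u - D' s u) t = partition_sum P D t - partition_sum P D' t"
  by (simp add: partition_sum_def sum_subtractf case_prod_beta)

lemma partition_sum_cmult:
  "partition_sum P (\<lambda>s u. c * D s u) t = c * partition_sum P D t"
  by (simp add: partition_sum_def sum_distrib_left case_prod_beta)

lemma partition_sum_sum: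
  "partition_sum P (\<lambda>s u. \<Sum>i\<in>I. D i s u) t = (\<Sum>i\<in>I. partition_sum P (D i) t)"
  unfolding partition_sum_def by (simp add: case_prod_beta) (rule sum.swap)

lemma partition_sum_mono:
  assumes "\<And>s u. (s, u) \<in> consecutive P \<Longrightarrow> D (min s t) (min u t) \<le> D' (min s t) (min u t)"
  shows "partition_sum P D t \<le> partition_sum P D' t"
  unfolding partition_sum_def by (rule sum_mono) (auto simp: assms)

lemma abs_partition_sum_le:
  assumes "\<And>s u. (s, u) \<in> consecutive P \<Longrightarrow> \<bar>D (min s t) (min u t)\<bar> \<le> D' (min s t) (min u t)"
  shows "\<bar>partition_sum P D t\<bar> \<le> partition_sum P D' t"
  unfolding partition_sum_def
  by (rule order_trans[OF sum_abs]) (auto intro!: sum_mono simp: assms)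

text \<open>Stopping at \<open>t\<close> never lengthens a cell, so an estimate valid on all short
  intervals applies to every stopped cell.\<close>

lemma abs_partition_sum_le_fine:
  assumes P: "partition_of T P" "finer_than \<delta> P" and t: "t \<in> {0..T}"
    and D: "\<And>s u. 0 \<le> s \<Longrightarrow> s \<le> u \<Longrightarrow> u \<le> T \<Longrightarrow> u - s < \<delta> \<Longrightarrow> \<bar>D s u\<bar> \<le> D' s u"
  shows "\<bar>partition_sum P D t\<bar> \<le> partition_sum P D' t"
proof (rule abs_partition_sum_le)
  fix s u assume su: "(s, u) \<in> consecutive P"
  have "u - s < \<delta>" using P(2) su by (auto simp: finer_than_def)
  then show "\<bar>D (min s t) (min u t)\<bar> \<le> D' (min s t) (min u t)"
    using consecutiveD[OF su] partition_ofD[OF P(1)] t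
    by (intro D) (auto simp: min_def)
qed

lemma consecutive_insert_max:
  assumes "finite P" "P \<noteq> {}" and lt: "\<And>x. x \<in> P \<Longrightarrow> x < m"
  shows "consecutive (insert m P) = insert (Max P, m) (consecutive P)"
proof -
  have M: "Max P \<in> P" "\<And>x. x \<in> P \<Longrightarrow> x \<le> Max P" using assms by auto
  have "(a, b) \<in> consecutive (insert m P) \<longleftrightarrow> a = Max P \<and> b = m \<or> (a, b) \<in> consecutive P" for a b
  proof (cases "b = m")
    case True
    have "m \<notin> P" using lt by blast
    moreover have "(a, m) \<in> consecutive (insert m P) \<longleftrightarrow> a \<in> P \<and> (\<forall>x\<in>P. x \<le> a)"
      unfolding consecutive_iff using lt by (auto simp: not_le dest: leD)
    moreover have "\<dots> \<longleftrightarrow> a = Max P" using M by (auto intro: antisym)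
    ultimately show ?thesis using True by (simp add: consecutive_iff)
  next
    case False
    have "b \<in> P \<Longrightarrow> b < m" using lt .
    then show ?thesis using False unfolding consecutive_iff by auto
  qed
  then show ?thesis by auto
qed

lemma sum_consecutive_telescope:
  assumes "finite P" "P \<noteq> {}"
  shows "(\<Sum>(s, u)\<in>consecutive P. h u - h s) = h (Max P) - (h (Min P) :: real)"
  using assms
proof (induction P rule: finite_linorder_max_induct)
  case (insert m P)
  show ?case
  proof (cases "P = {}")
    case True
    then show ?thesis by (auto simp: consecutive_def intro!: sum.neutral)
  next
    case False
    have lt: "\<And>x. x \<in> P \<Longrightarrow> x < m" using insert by auto
    then have "(Max P, m) \<notin> consecutive P" by (auto simp: consecutive_def)
    moreover have "Max (insert m P) = m" "Min (insert m P) = Min P"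
      using insert(1) False lt[OF Max_in[OF insert(1) False]] lt[OF Min_in[OF insert(1) False]]
      by simp_all
    ultimately show ?thesis
      using insert False consecutive_insert_max[OF insert(1) False lt] by simp
  qed
qed simp

lemma partition_sum_telescope:
  assumes "partition_of T P" "t \<in> {0..T}"
  shows "partition_sum P (\<lambda>s u. h u - h s) t = h t - h 0"
proof -
  note P = partition_ofD[OF assms(1)]
  have "Max P = T" "Min P = 0"
    using P by (auto intro!: Max_eqI Min_eqI)
  moreover have "P \<noteq> {}" using P by auto
  ultimately show ?thesis
    using sum_consecutive_telescope[OF P(1), of "\<lambda>x. h (min x t)"] assms(2)
    by (simp add: partition_sum_def min_absorb1 min_absorb2)
qed

lemma partition_sum_0:
  assumes "partition_of T P" "\<And>x. D x x = 0"
  shows "partition_sum P D 0 = 0"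
proof -
  have "D (min s 0) (min u 0) = 0" if "(s, u) \<in> consecutive P" for s u
    using partition_ofD(4)[OF assms(1)] consecutiveD(1,2)[OF that] by (simp add: min_absorb2 assms(2))
  then show ?thesis unfolding partition_sum_def by (auto intro!: sum.neutral)
qed

section \<open>Step functions that freeze an integrand on the cells of a coarser partition\<close>

definition left_point :: "real set \<Rightarrow> real \<Rightarrow> real" where
  "left_point P x = Max {p \<in> P. p \<le> x}"

lemma left_point_eq:
  assumes "(s, u) \<in> consecutive P" "finite P" "s \<le> x" "x < u"
  shows "left_point P x = s"
  unfolding left_point_def using consecutiveD[OF assms(1)] assms(2-)
  by (intro Max_eqI) force+

lemma left_point_fine:
  assumes P: "partition_of T P" "finer_than \<delta> P" and x: "0 \<le> x" "x < T"
  shows "left_point P x \<in> {0..T}" "\<bar>x - left_point P x\<bar> < \<delta>"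
proof -
  note P' = partition_ofD[OF P(1)]
  define s u where "s = left_point P x" and "u = Min {p \<in> P. x < p}"
  have s: "s \<in> {p \<in> P. p \<le> x}"
    unfolding s_def left_point_def using P' x by (intro Max_in) auto
  have u: "u \<in> {p \<in> P. x < p}"
    unfolding u_def using P' x by (intro Min_in) auto
  have "y \<le> s \<or> u \<le> y" if "y \<in> P" for y
    using that P'(1) unfolding s_def u_def left_point_def
    by (cases "y \<le> x") (auto intro!: Max_ge Min_le)
  then have "(s, u) \<in> consecutive P" using s u by (fastforce simp: consecutive_def)
  then have "u - s < \<delta>" using P by (auto simp: finer_than_def)
  then show "\<bar>x - left_point P x\<bar> < \<delta>" "left_point P x \<in> {0..T}"
    using s u P'(4,5) by (auto simp: s_def[symmetric])
qed

text \<open>Since \<open>P \<subseteq> Q\<close>, every cell of \<open>Q\<close> lies in one cell of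
  \<open>P\<close>, and its start is sent by \<open>left_point P\<close> to the start of that cell.
  The increment of the \<open>Q\<close>-sum over a cell of \<open>P\<close> collects just the
  \<open>Q\<close>-cells inside it.\<close>

lemma partition_sum_coarsen:
  assumes P: "partition_of T P" and Q: "partition_of T Q" and PQ: "P \<subseteq> Q"
    and D: "\<And>x. D x x = 0" and t: "t \<in> {0..T}"
  shows "partition_sum P (\<lambda>s u. f s * (partition_sum Q D u - partition_sum Q D s)) t =
         partition_sum Q (\<lambda>s u. f (left_point P s) * D s u) t"
proof -
  \<comment> \<open>\<open>h\<close> is the right-hand side as a function of the stopping time. The
    summands on the left turn out to be the increments of \<open>h\<close> over the cells of
    \<open>P\<close>, so the sum telescopes.\<close>
  define h where "h v = partition_sum Q (\<lambda>s u. f (left_point P s) * D s u) v" for v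
  have "partition_sum P (\<lambda>s u. f s * (partition_sum Q D u - partition_sum Q D s)) t =
        partition_sum P (\<lambda>s u. h u - h s) t"
  proof (rule partition_sum_cong)
    fix s u assume su: "(s, u) \<in> consecutive P"
    show "f (min s t) * (partition_sum Q D (min u t) - partition_sum Q D (min s t)) =
      h (min u t) - h (min s t)"
    proof (cases "s < t")
      case False
      then show ?thesis using consecutiveD(3)[OF su] by simp
    next
      case True
      define v where "v = min u t"
      have v: "s < v" "v \<le> u" using True consecutiveD(3)[OF su] by (auto simp: v_def)
      have sQ: "s \<in> Q" using consecutiveD(1)[OF su] PQ by auto
      \<comment> \<open>Comparison for each cell of \<open>Q\<close>: one that ends by
        \<open>s\<close> contributes nothing to either side, one that starts in
        \<open>[s, v)\<close> has left point \<open>s\<close>, and one that starts at or after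
        \<open>v\<close> vanishes because \<open>D x x = 0\<close>.\<close>
      have "f s * (D (min a v) (min b v) - D (min a s) (min b s)) =
            f (left_point P (min a v)) * D (min a v) (min b v) -
            f (left_point P (min a s)) * D (min a s) (min b s)" if ab: "(a, b) \<in> consecutive Q" for a b
      proof (cases "b \<le> s")
        case True
        then show ?thesis using v consecutiveD(3)[OF ab] by (simp add: min_absorb1)
      next
        case False
        then have a: "s \<le> a" using consecutiveD(4)[OF ab sQ] by auto
        show ?thesis
        proof (cases "a < v")
          case True
          then have "left_point P a = s"
            using left_point_eq[OF su partition_ofD(1)[OF P] a] v by simp
          then show ?thesis using a True False D by (simp add: min_absorb2 min_absorb1)
        next
          case False
          then show ?thesis using a D consecutiveD(3)[OF ab] v by (simp add: min_absorb2)
        qed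
      qed
      then show ?thesis
        using True unfolding h_def partition_sum_def v_def[symmetric]
        by (auto simp: min_absorb1 sum_subtractf[symmetric] sum_distrib_left intro!: sum.cong)
    qed
  qed
  also have "\<dots> = h t - h 0" by (rule partition_sum_telescope[OF P t])
  also have "h 0 = 0" unfolding h_def by (rule partition_sum_0[OF Q]) (simp add: D)
  finally show ?thesis by (simp add: h_def)
qed

text \<open>By \<open>partition_sum_coarsen\<close> the difference is a sum along \<open>Q\<close>
  with weights \<open>f s - f (left_point P s)\<close>, and \<open>s\<close> is within \<delta> of
  its left point.\<close>

lemma partition_sum_coarsen_error:
  assumes P: "partition_of T P" "finer_than \<delta> P" and Q: "partition_of T Q" and PQ: "P \<subseteq> Q"
    and D: "\<And>x. D x x = 0" and t: "t \<in> {0..T}"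
    and f: "\<And>x y. x \<in> {0..T} \<Longrightarrow> y \<in> {0..T} \<Longrightarrow> \<bar>x - y\<bar> < \<delta> \<Longrightarrow> \<bar>f x - f y\<bar> \<le> e"
  shows "\<bar>partition_sum Q (\<lambda>s u. f s * D s u) t -
          partition_sum P (\<lambda>s u. f s * (partition_sum Q D u - partition_sum Q D s)) t\<bar>
         \<le> e * partition_sum Q (\<lambda>s u. \<bar>D s u\<bar>) t"
proof -
  have "\<bar>partition_sum Q (\<lambda>s u. f s * D s u - f (left_point P s) * D s u) t\<bar> \<le>
        partition_sum Q (\<lambda>s u. e * \<bar>D s u\<bar>) t"
  proof (rule abs_partition_sum_le)
    fix s u assume su: "(s, u) \<in> consecutive Q"
    have s: "0 \<le> s" "s < T" using consecutiveD(1-3)[OF su] partition_ofD[OF Q] by force+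
    show "\<bar>f (min s t) * D (min s t) (min u t) - f (left_point P (min s t)) * D (min s t) (min u t)\<bar>
          \<le> e * \<bar>D (min s t) (min u t)\<bar>"
    proof (cases "s < t")
      case True
      then have "\<bar>f s - f (left_point P s)\<bar> \<le> e"
        using s left_point_fine[OF P s] by (intro f) auto
      then show ?thesis using True
        by (simp add: left_diff_distrib[symmetric] abs_mult mult_right_mono min_absorb1)
    next
      case False
      then show ?thesis using D consecutiveD(3)[OF su] by (simp add: min_absorb2)
    qed
  qed
  then show ?thesis
    by (simp add: partition_sum_diff partition_sum_cmult partition_sum_coarsen[OF P(1) Q PQ D t])
qed

section \<open>Limits of weighted sums along refining partitions\<close>

lemma refining_partitionsD:
  assumes "refining_partitions T \<pi>"
  shows "partition_of T (\<pi> n)" "m \<le> n \<Longrightarrow> \<pi> m \<subseteq> \<pi> n"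
    "0 < \<delta> \<Longrightarrow> eventually (\<lambda>n. finer_than \<delta> (\<pi> n)) sequentially"
proof -
  have P: "partition_of T (\<pi> n)" for n using assms by (auto simp: refining_partitions_def partition_of_def)
  then show "partition_of T (\<pi> n)" .
  show "m \<le> n \<Longrightarrow> \<pi> m \<subseteq> \<pi> n"
    using assms by (elim lift_Suc_mono_le[of \<pi>, rotated]) (simp add: refining_partitions_def)
  assume "0 < \<delta>"
  have "(\<lambda>n. mesh (\<pi> n)) \<longlonglongrightarrow> 0" using assms by (simp add: refining_partitions_def)
  then have "eventually (\<lambda>n. mesh (\<pi> n) < \<delta>) sequentially" using \<open>0 < \<delta>\<close> by (rule order_tendstoD)
  then show "eventually (\<lambda>n. finer_than \<delta> (\<pi> n)) sequentially"
  proof eventually_elim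
    case (elim n)
    have "u - s \<le> mesh (\<pi> n)" if "(s, u) \<in> consecutive (\<pi> n)" for s u
      unfolding mesh_def using that partition_ofD(1)[OF P[of n]]
      by (intro Max_ge finite_imageI finite_consecutive) (auto intro: rev_image_eqI)
    then show ?case using elim unfolding finer_than_def by (auto intro: le_less_trans)
  qed
qed

lemma tendsto_partition_sum:
  assumes "partition_of T P" "t \<in> {0..T}"
    and "\<And>s u. s \<in> {0..T} \<Longrightarrow> u \<in> {0..T} \<Longrightarrow> (\<lambda>n. D n s u) \<longlonglongrightarrow> D' s u"
  shows "(\<lambda>n. partition_sum P (D n) t) \<longlonglongrightarrow> partition_sum P D' t"
  unfolding partition_sum_def case_prod_beta
proof (rule tendsto_sum)
  fix p assume p: "p \<in> consecutive P"
  then have "fst p \<in> P" "snd p \<in> P" by (auto simp: consecutive_def)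
  then have "min (fst p) t \<in> {0..T}" "min (snd p) t \<in> {0..T}"
    using partition_ofD(4)[OF assms(1)] assms(2) by auto
  then show "(\<lambda>n. D n (min (fst p) t) (min (snd p) t)) \<longlonglongrightarrow> D' (min (fst p) t) (min (snd p) t)"
    by (rule assms(3))
qed

lemma continuous_on_partition_sum:
  assumes "partition_of T P" "continuous_on {0..T} f" "continuous_on {0..T} W"
  shows "continuous_on {0..T} (partition_sum P (\<lambda>s u. f s * (W u - W s)))"
  unfolding partition_sum_def case_prod_beta
proof (rule continuous_on_sum)
  fix p assume p: "p \<in> consecutive P"
  then have "fst p \<in> P" "snd p \<in> P" by (auto simp: consecutive_def)
  then have *: "0 \<le> fst p" "0 \<le> snd p" using partition_ofD(4)[OF assms(1)] by auto
  have "continuous_on {0..T} (\<lambda>t. g (min c t))" if "continuous_on {0..T} g" "0 \<le> c" for c and g :: "real \<Rightarrow> real"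
    using that by (intro continuous_on_compose2[OF that(1)] continuous_intros) auto
  then show "continuous_on {0..T}
      (\<lambda>t. f (min (fst p) t) * (W (min (snd p) t) - W (min (fst p) t)))"
    using assms * by (intro continuous_intros) auto
qed

lemma uniformly_continuous_real:
  fixes f :: "real \<Rightarrow> real"
  assumes "continuous_on {0..T} f" "0 < e"
  obtains \<delta> where "0 < \<delta>"
    "\<And>x y. x \<in> {0..T} \<Longrightarrow> y \<in> {0..T} \<Longrightarrow> \<bar>x - y\<bar> < \<delta> \<Longrightarrow> \<bar>f x - f y\<bar> \<le> e"
proof -
  have "uniformly_continuous_on {0..T} f" using assms(1) by (rule compact_uniformly_continuous) simp
  then obtain \<delta> where "0 < \<delta>" "\<And>x y. x \<in> {0..T} \<Longrightarrow> y \<in> {0..T} \<Longrightarrow> dist x y < \<delta> \<Longrightarrow> dist (f x) (f y) < e"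
    using assms(2) unfolding uniformly_continuous_on_def by metis
  then show ?thesis using that[of \<delta>] by (force simp: dist_real_def intro: less_imp_le)
qed

lemma weighted_partition_sum_limit:
  assumes \<pi>: "refining_partitions T \<pi>"
    and D0: "\<And>x. D x x = 0"
    and W: "\<And>t. t \<in> {0..T} \<Longrightarrow> (\<lambda>n. partition_sum (\<pi> n) D t) \<longlonglongrightarrow> W t"
    and K: "\<And>t. t \<in> {0..T} \<Longrightarrow>
          eventually (\<lambda>n. partition_sum (\<pi> n) (\<lambda>s u. \<bar>D s u\<bar>) t \<le> K) sequentially"
    and f: "continuous_on {0..T} f"
  obtains J where
    "\<And>t. t \<in> {0..T} \<Longrightarrow> (\<lambda>n. partition_sum (\<pi> n) (\<lambda>s u. f s * D s u) t) \<longlonglongrightarrow> J t"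
    "uniform_limit {0..T} (\<lambda>m. partition_sum (\<pi> m) (\<lambda>s u. f s * (W u - W s))) J sequentially"
proof -
  define a where "a n = partition_sum (\<pi> n) (\<lambda>s u. f s * D s u)" for n
  define c where "c m = partition_sum (\<pi> m) (\<lambda>s u. f s * (W u - W s))" for m
  note part = refining_partitionsD(1)[OF \<pi>]
  \<comment> \<open>The threshold for \<open>m\<close> does not depend on \<open>t\<close>, which
    yields uniform convergence of \<open>c\<close>; the one for \<open>n\<close> may depend on
    \<open>t\<close>, as the convergence to \<open>W\<close> is only pointwise.\<close>
  have key: "eventually (\<lambda>m. \<forall>t\<in>{0..T}. eventually (\<lambda>n. \<bar>a n t - c m t\<bar> < e) sequentially) sequentially"
    if "0 < e" for e
  proof -
    \<comment> \<open>Chosen to make \<open>e' * K\<close> at most \<open>e / 2\<close>; the sign of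
      \<open>K\<close> is not known, hence the absolute value and the summand 1.\<close>
    define e' where "e' = e / (2 * (\<bar>K\<bar> + 1))"
    have "0 < e'" using that by (simp add: e'_def add_nonneg_pos)
    from uniformly_continuous_real[OF f this] obtain \<delta> where \<delta>: "0 < \<delta>"
      "\<And>x y. x \<in> {0..T} \<Longrightarrow> y \<in> {0..T} \<Longrightarrow> \<bar>x - y\<bar> < \<delta> \<Longrightarrow> \<bar>f x - f y\<bar> \<le> e'" by blast
    have "e' * K \<le> e' * (\<bar>K\<bar> + 1)" using \<open>0 < e'\<close> by (intro mult_left_mono) auto
    also have "\<dots> = e / 2" by (simp add: e'_def field_simps add_nonneg_pos)
    finally have e'K: "e' * K \<le> e / 2" .
    show ?thesis
      using refining_partitionsD(3)[OF \<pi> \<delta>(1)]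
    proof eventually_elim
      case (elim m)
      show ?case
      proof
        fix t assume t: "t \<in> {0..T}"
        define c' where "c' n = partition_sum (\<pi> m)
          (\<lambda>s u. f s * (partition_sum (\<pi> n) D u - partition_sum (\<pi> n) D s)) t" for n
        have "c' \<longlonglongrightarrow> c m t"
          unfolding c'_def c_def
          by (intro tendsto_partition_sum[OF part t] tendsto_intros W) auto
        then have "eventually (\<lambda>n. \<bar>c' n - c m t\<bar> < e / 2) sequentially"
          using tendstoD[of c' "c m t" sequentially "e / 2"] that by (simp add: dist_real_def)
        then show "eventually (\<lambda>n. \<bar>a n t - c m t\<bar> < e) sequentially"
          using K[OF t] eventually_ge_at_top[of m]
        proof eventually_elim
          case (elim n)
          have "\<bar>a n t - c' n\<bar> \<le> e' * partition_sum (\<pi> n) (\<lambda>s u. \<bar>D s u\<bar>) t"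
            unfolding a_def c'_def
            by (rule partition_sum_coarsen_error[OF part \<open>finer_than \<delta> (\<pi> m)\<close> part
                  refining_partitionsD(2)[OF \<pi> \<open>m \<le> n\<close>] D0 t \<delta>(2)])
          also have "\<dots> \<le> e / 2" using elim \<open>0 < e'\<close> e'K
            by (meson less_imp_le mult_left_mono order_trans)
          finally show ?case using elim by linarith
        qed
      qed
    qed
  qed
  define J where "J t = lim (\<lambda>n. a n t)" for t
  have J: "(\<lambda>n. a n t) \<longlonglongrightarrow> J t" if t: "t \<in> {0..T}" for t
  proof -
    \<comment> \<open>A single \<open>m\<close> suffices: all late terms are close to the same
      number \<open>c m t\<close>.\<close>
    have "Cauchy (\<lambda>n. a n t)"
    proof (rule metric_CauchyI)
      fix e :: real assume "0 < e"
      then obtain m where "eventually (\<lambda>n. \<bar>a n t - c m t\<bar> < e / 2) sequentially"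
        using eventually_happens'[OF sequentially_bot key[OF half_gt_zero]] t by blast
      then obtain N where "\<And>n. n \<ge> N \<Longrightarrow> \<bar>a n t - c m t\<bar> < e / 2"
        by (auto simp: eventually_sequentially)
      then show "\<exists>M. \<forall>i\<ge>M. \<forall>j\<ge>M. dist (a i t) (a j t) < e"
        unfolding dist_real_def by (intro exI[of _ N] allI impI) (smt (verit) field_sum_of_halves)
    qed
    then show ?thesis unfolding J_def by (simp add: Cauchy_convergent convergent_LIMSEQ_iff[symmetric])
  qed
  have "uniform_limit {0..T} c J sequentially"
  proof (rule uniform_limitI)
    fix e :: real assume "0 < e"
    then have "eventually (\<lambda>m. \<forall>t\<in>{0..T}. eventually (\<lambda>n. \<bar>a n t - c m t\<bar> < e / 2) sequentially) sequentially"
      by (intro key) simp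
    then show "eventually (\<lambda>m. \<forall>t\<in>{0..T}. dist (c m t) (J t) < e) sequentially"
    proof eventually_elim
      case (elim m)
      show ?case
      proof
        fix t assume t: "t \<in> {0..T}"
        have "(\<lambda>n. \<bar>a n t - c m t\<bar>) \<longlonglongrightarrow> \<bar>J t - c m t\<bar>" by (intro tendsto_intros J t)
        moreover have "eventually (\<lambda>n. \<bar>a n t - c m t\<bar> \<le> e / 2) sequentially"
          using bspec[OF elim t] by (rule eventually_mono) (rule less_imp_le)
        ultimately have "\<bar>J t - c m t\<bar> \<le> e / 2"
          by (rule tendsto_upperbound) simp
        then show "dist (c m t) (J t) < e" using \<open>0 < e\<close> unfolding dist_real_def by linarith
      qed
    qed
  qed
  with J show ?thesis unfolding a_def c_def by (intro that)
qed

text \<open>Each frozen sum is continuous in the stopping time, and a uniform limit of continuous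
  functions is continuous.\<close>

lemma weighted_partition_sum_limit_continuous:
  assumes "refining_partitions T \<pi>" "continuous_on {0..T} f" "continuous_on {0..T} W"
    and "uniform_limit {0..T} (\<lambda>m. partition_sum (\<pi> m) (\<lambda>s u. f s * (W u - W s))) J sequentially"
  shows "continuous_on {0..T} J"
  using assms(4)
  by (rule uniform_limit_theorem[rotated])
    (auto intro!: always_eventually continuous_on_partition_sum assms refining_partitionsD)

section \<open>Taylor expansion along a path\<close>

text \<open>The coordinates are moved one at a time, with the mean value theorem applied to each
  move. All intermediate points stay in the box around \<open>x\<close> with half-widths
  \<open>\<bar>h $ k\<bar>\<close>, which is where \<open>close\<close> supplies the bound.\<close>

lemma coordinate_linearization:
  fixes f :: "real^'n \<Rightarrow> real"
  assumes deriv: "\<And>i y. ((\<lambda>\<tau>. f (y + \<tau> *\<^sub>R axis i 1)) has_real_derivative f' i y) (at 0)"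
    and close: "\<And>i y. (\<And>k. \<bar>y $ k - x $ k\<bar> \<le> \<bar>h $ k\<bar>) \<Longrightarrow> \<bar>f' i y - c i\<bar> \<le> e"
  shows "\<bar>f (x + h) - f x - (\<Sum>i\<in>UNIV. c i * h $ i)\<bar> \<le> e * (\<Sum>i\<in>UNIV. \<bar>h $ i\<bar>)"
proof -
  \<comment> \<open>\<open>p I\<close> is the point at which exactly the coordinates in
    \<open>I\<close> have been moved.\<close>
  define p where "p I = x + (\<chi> i. if i \<in> I then h $ i else 0)" for I
  have "\<bar>f (p I) - f x - (\<Sum>i\<in>I. c i * h $ i)\<bar> \<le> e * (\<Sum>i\<in>I. \<bar>h $ i\<bar>)" if "finite I" for I
    using that
  proof induction
    case empty
    then show ?case by (simp add: p_def zero_vec_def[symmetric])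
  next
    case (insert j I)
    \<comment> \<open>With the linear term subtracted, the derivative contains the difference
      \<open>f' j - c j\<close> that \<open>close\<close> controls.\<close>
    define \<phi> where "\<phi> \<tau> = f (p I + (\<tau> * h $ j) *\<^sub>R axis j 1) - c j * h $ j * \<tau>" for \<tau>
    have d: "(\<phi> has_real_derivative (f' j (p I + (\<tau> * h $ j) *\<^sub>R axis j 1) - c j) * h $ j) (at \<tau>)" for \<tau>
    proof -
      define y where "y = p I + (\<tau> * h $ j) *\<^sub>R axis j 1"
      \<comment> \<open>\<open>deriv\<close> differentiates only at parameter 0, so the base point
        is shifted to \<open>y\<close> and the parameter written as
        \<open>(\<tau> - \<tau>) * h $ j\<close>.\<close>
      have 1: "((\<lambda>r. f (y + r *\<^sub>R axis j 1)) has_real_derivative f' j y) (at ((\<tau> - \<tau>) * h $ j))"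
        using deriv by simp
      have "((\<lambda>r. (r - \<tau>) * h $ j) has_real_derivative h $ j) (at \<tau>)"
        by (auto intro!: derivative_eq_intros)
      from DERIV_chain2[OF 1 this]
      have "((\<lambda>r. f (y + ((r - \<tau>) * h $ j) *\<^sub>R axis j 1)) has_real_derivative f' j y * h $ j) (at \<tau>)" .
      also have "(\<lambda>r. f (y + ((r - \<tau>) * h $ j) *\<^sub>R axis j 1)) = (\<lambda>r. f (p I + (r * h $ j) *\<^sub>R axis j 1))"
        by (simp add: y_def algebra_simps)
      finally show ?thesis
        unfolding \<phi>_def y_def by (auto intro!: derivative_eq_intros simp: algebra_simps)
    qed
    obtain \<tau> where \<tau>: "0 < \<tau>" "\<tau> < 1"
      "\<phi> 1 - \<phi> 0 = (1 - 0) * ((f' j (p I + (\<tau> * h $ j) *\<^sub>R axis j 1) - c j) * h $ j)"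
      using MVT2[of 0 1 \<phi>, OF _ d] by auto
    have "\<bar>f' j (p I + (\<tau> * h $ j) *\<^sub>R axis j 1) - c j\<bar> \<le> e"
      using \<tau> insert(2) by (intro close) (auto simp: p_def axis_def abs_mult mult_left_le_one_le)
    then have "\<bar>\<phi> 1 - \<phi> 0\<bar> \<le> e * \<bar>h $ j\<bar>" using \<tau> by (simp add: abs_mult mult_right_mono)
    moreover have "p I + h $ j *\<^sub>R axis j 1 = p (insert j I)"
      using insert(2) by (auto simp: p_def vec_eq_iff axis_def)
    then have "\<phi> 1 - \<phi> 0 = f (p (insert j I)) - f (p I) - c j * h $ j" by (simp add: \<phi>_def)
    ultimately show ?case using insert by (simp add: algebra_simps)
  qed
  from this[of UNIV] show ?thesis by (simp add: p_def)
qed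

text \<open>Continuous partial derivatives make \<open>f\<close> Frechet differentiable, by
  \<open>coordinate_linearization\<close> with \<open>c\<close> the partial derivatives at the base
  point; the chain rule along the line does the rest.\<close>

lemma line_derivative:
  fixes f :: "real^'n \<Rightarrow> real"
  assumes deriv: "\<And>i y. ((\<lambda>\<tau>. f (y + \<tau> *\<^sub>R axis i 1)) has_real_derivative f' i y) (at 0)"
    and cont: "\<And>i. continuous_on UNIV (f' i)"
  shows "((\<lambda>\<tau>. f (x + \<tau> *\<^sub>R h)) has_real_derivative (\<Sum>i\<in>UNIV. f' i (x + \<tau> *\<^sub>R h) * h $ i)) (at \<tau>)"
proof -
  define y where "y = x + \<tau> *\<^sub>R h"
  have "(f has_derivative (\<lambda>k. \<Sum>i\<in>UNIV. f' i y * k $ i)) (at y)"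
  proof (rule has_derivativeI)
    show "bounded_linear (\<lambda>k. \<Sum>i\<in>UNIV. f' i y * k $ i)"
      by (intro bounded_linear_sum bounded_linear_const_mult bounded_linear_vec_nth)
    have "((\<lambda>z. norm (f z - f y - (\<Sum>i\<in>UNIV. f' i y * (z - y) $ i)) / norm (z - y)) \<longlongrightarrow> 0) (at y)"
    proof (rule tendstoI)
      fix e :: real assume "0 < e"
      \<comment> \<open>The sum of the absolute coordinates is at most \<open>CARD('n)\<close> times
        the norm, so the error becomes \<open>e / 2\<close> times the norm and the final inequality
        is strict.\<close>
      define e' where "e' = e / (2 * real CARD('n))"
      have e': "0 < e'" using \<open>0 < e\<close> by (simp add: e'_def)
      have "(f' i \<longlongrightarrow> f' i y) (nhds y)" for i
        using cont[of i] by (simp add: continuous_on_eq_continuous_at isCont_def tendsto_at_iff_tendsto_nhds)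
      then have "eventually (\<lambda>z. \<forall>i. dist (f' i z) (f' i y) < e') (nhds y)"
        using e' by (intro eventually_all_finite tendstoD)
      then obtain d where d: "0 < d" "\<And>z i. dist z y < d \<Longrightarrow> dist (f' i z) (f' i y) < e'"
        by (auto simp: eventually_nhds_metric)
      show "eventually (\<lambda>z. dist (norm (f z - f y - (\<Sum>i\<in>UNIV. f' i y * (z - y) $ i)) / norm (z - y)) 0 < e) (at y)"
        unfolding eventually_at
      proof (intro exI[of _ d] conjI d(1) ballI impI, elim conjE)
        fix z assume z: "z \<noteq> y" "dist z y < d"
        have "\<bar>f (y + (z - y)) - f y - (\<Sum>i\<in>UNIV. f' i y * (z - y) $ i)\<bar> \<le> e' * (\<Sum>i\<in>UNIV. \<bar>(z - y) $ i\<bar>)"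
        proof (rule coordinate_linearization[OF deriv])
          fix i w assume w: "\<And>k. \<bar>w $ k - y $ k\<bar> \<le> \<bar>(z - y) $ k\<bar>"
          have "norm (w - y) \<le> norm (z - y)"
            by (rule norm_le_componentwise_cart) (use w in simp)
          then have "dist w y < d" using z by (simp add: dist_norm)
          then show "\<bar>f' i w - f' i y\<bar> \<le> e'" using d(2)[of w i] by (simp add: dist_real_def)
        qed
        also have "(\<Sum>i\<in>UNIV. \<bar>(z - y) $ i\<bar>) \<le> (\<Sum>i\<in>(UNIV::'n set). norm (z - y))"
          by (intro sum_mono component_le_norm_cart)
        also have "e' * (\<Sum>i\<in>(UNIV::'n set). norm (z - y)) = e / 2 * norm (z - y)"
          by (simp add: e'_def)
        finally have "norm (f z - f y - (\<Sum>i\<in>UNIV. f' i y * (z - y) $ i)) / norm (z - y) \<le> e / 2"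
          using z e' by (simp add: divide_le_eq mult_left_mono)
        then have "norm (f z - f y - (\<Sum>i\<in>UNIV. f' i y * (z - y) $ i)) / norm (z - y) < e"
          using \<open>0 < e\<close> by linarith
        then show "dist (norm (f z - f y - (\<Sum>i\<in>UNIV. f' i y * (z - y) $ i)) / norm (z - y)) 0 < e"
          by simp
      qed
    qed
    then show "((\<lambda>z. (f z - f y - (\<Sum>i\<in>UNIV. f' i y * (z - y) $ i)) /\<^sub>R norm (z - y)) \<longlongrightarrow> 0) (at y)"
      by (subst tendsto_norm_zero_iff[symmetric]) (simp add: divide_inverse mult.commute abs_mult)
  qed
  moreover have "((\<lambda>\<tau>. x + \<tau> *\<^sub>R h) has_derivative (\<lambda>r. r *\<^sub>R h)) (at \<tau>)"
    by (auto intro!: derivative_eq_intros)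
  ultimately have "((\<lambda>\<tau>. f (x + \<tau> *\<^sub>R h)) has_derivative (\<lambda>r. \<Sum>i\<in>UNIV. f' i y * (r *\<^sub>R h) $ i)) (at \<tau>)"
    unfolding y_def by (rule has_derivative_compose[rotated])
  then show ?thesis
    unfolding has_field_derivative_def y_def[symmetric]
    by (rule has_derivative_eq_rhs) (simp add: fun_eq_iff sum_distrib_left algebra_simps)
qed

text \<open>Maclaurin's formula of order two with Lagrange remainder, applied to \<open>f\<close>
  along the segment from \<open>x\<close> to \<open>x + h\<close>.\<close>

lemma second_order_expansion:
  fixes f :: "real^'n \<Rightarrow> real"
  assumes deriv: "\<And>i y. ((\<lambda>\<tau>. f (y + \<tau> *\<^sub>R axis i 1)) has_real_derivative f' i y) (at 0)"
    and cont: "\<And>i. continuous_on UNIV (f' i)"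
    and deriv2: "\<And>i j y. ((\<lambda>\<tau>. f' i (y + \<tau> *\<^sub>R axis j 1)) has_real_derivative f'' i j y) (at 0)"
    and cont2: "\<And>i j. continuous_on UNIV (f'' i j)"
  obtains \<tau> where "0 < \<tau>" "\<tau> < 1"
    "f (x + h) = f x + (\<Sum>i\<in>UNIV. f' i x * h $ i) +
       (\<Sum>i\<in>UNIV. \<Sum>j\<in>UNIV. f'' i j (x + \<tau> *\<^sub>R h) * (h $ i * h $ j)) / 2"
proof -
  define \<phi>' where "\<phi>' \<tau> = (\<Sum>i\<in>UNIV. f' i (x + \<tau> *\<^sub>R h) * h $ i)" for \<tau>
  define \<phi>'' where "\<phi>'' \<tau> = (\<Sum>i\<in>UNIV. \<Sum>j\<in>UNIV. f'' i j (x + \<tau> *\<^sub>R h) * (h $ i * h $ j))" for \<tau>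
  define diff where "diff n = (if n = 0 then (\<lambda>\<tau>. f (x + \<tau> *\<^sub>R h)) else if n = 1 then \<phi>' else \<phi>'')" for n :: nat
  have 1: "((\<lambda>\<tau>. f (x + \<tau> *\<^sub>R h)) has_real_derivative \<phi>' \<tau>) (at \<tau>)" for \<tau>
    unfolding \<phi>'_def by (rule line_derivative[OF deriv cont])
  have 2: "(\<phi>' has_real_derivative \<phi>'' \<tau>) (at \<tau>)" for \<tau>
    unfolding \<phi>'_def \<phi>''_def
    by (auto intro!: derivative_eq_intros line_derivative[OF deriv2 cont2] sum.cong
      simp: sum_distrib_left algebra_simps)
  have "\<exists>\<tau>. 0 < \<tau> \<and> \<tau> < 1 \<and> f (x + 1 *\<^sub>R h) =
      (\<Sum>m<2. diff m 0 / fact m * 1 ^ m) + diff 2 \<tau> / fact 2 * 1\<^sup>2"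
    by (rule Maclaurin[of 1 2 diff "\<lambda>\<tau>. f (x + \<tau> *\<^sub>R h)"])
      (auto simp: diff_def less_2_cases_iff 1 2)
  then show ?thesis
    using that by (auto simp: diff_def numeral_2_eq_2 \<phi>'_def \<phi>''_def)
qed

section \<open>Regularity of the generating function and its expansion along a continuous
  path\<close>

lemma C1_fstD:
  fixes G :: "(real^'d) \<times> (real^'m) \<Rightarrow> real"
  assumes "C1_fst G"
  shows "((\<lambda>\<tau>. G (y + \<tau> *\<^sub>R axis i 1, a)) has_real_derivative pd_fst i G (y, a)) (at 0)"
    "continuous_on UNIV (pd_fst i G)"
  using assms by (auto simp: C1_fst_def pd_fst_def DERIV_deriv_iff_field_differentiable)

lemma C1_sndD:
  fixes G :: "(real^'d) \<times> (real^'m) \<Rightarrow> real"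
  assumes "C1_snd G"
  shows "((\<lambda>\<tau>. G (x, b + \<tau> *\<^sub>R axis l 1)) has_real_derivative pd_snd l G (x, b)) (at 0)"
    "continuous_on UNIV (pd_snd l G)"
  using assms by (auto simp: C1_snd_def pd_snd_def DERIV_deriv_iff_field_differentiable)

lemma continuous_on_fst_slice:
  assumes "continuous_on UNIV F"
  shows "continuous_on UNIV (\<lambda>x. F (x, a))"
  by (rule continuous_on_compose2[OF assms]) (auto intro!: continuous_intros)

text \<open>Intermediate points of Taylor expansions need not lie on the path, but they are no
  farther from its point at \<open>s\<close> than the path at \<open>u\<close>. All of them stay in
  a compact set, on which \<Phi> is uniformly continuous.\<close>

lemma uniform_near_path:
  fixes x :: "real \<Rightarrow> 'a::euclidean_space" and a :: "real \<Rightarrow> 'b::euclidean_space"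
    and \<Phi> :: "'a \<times> 'b \<Rightarrow> 'c::metric_space"
  assumes x: "continuous_on {0..T} x" and a: "continuous_on {0..T} a"
    and \<Phi>: "continuous_on UNIV \<Phi>" and e: "0 < e"
  obtains \<delta> where "0 < \<delta>"
    "\<And>s u y b. \<lbrakk>s \<in> {0..T}; u \<in> {0..T}; \<bar>s - u\<bar> < \<delta>; norm (y - x s) \<le> norm (x u - x s);
       norm (b - a s) \<le> norm (a u - a s)\<rbrakk> \<Longrightarrow> dist (\<Phi> (y, b)) (\<Phi> (x s, a s)) < e"
proof -
  have "bounded (x ` {0..T})" "bounded (a ` {0..T})"
    using x a by (auto intro!: compact_imp_bounded compact_continuous_image)
  then obtain R S where RS: "\<And>t. t \<in> {0..T} \<Longrightarrow> norm (x t) \<le> R" "\<And>t. t \<in> {0..T} \<Longrightarrow> norm (a t) \<le> S"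
    unfolding bounded_iff by (metis imageI)
  \<comment> \<open>The radius comes from
    \<open>norm y \<le> norm (x s) + norm (x u - x s) \<le> 3 * R\<close>, and likewise for
    \<open>b\<close>.\<close>
  define C where "C = cball (0::'a) (3 * R) \<times> cball (0::'b) (3 * S)"
  have "uniformly_continuous_on C \<Phi>"
    unfolding C_def
    by (intro compact_uniformly_continuous continuous_on_subset[OF \<Phi>] compact_Times) auto
  then obtain d where d: "0 < d"
    "\<And>z z'. z \<in> C \<Longrightarrow> z' \<in> C \<Longrightarrow> dist z z' < d \<Longrightarrow> dist (\<Phi> z) (\<Phi> z') < e"
    using e unfolding uniformly_continuous_on_def by metis
  have "uniformly_continuous_on {0..T} x" "uniformly_continuous_on {0..T} a"
    using x a by (auto intro: compact_uniformly_continuous)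
  then obtain \<delta>1 \<delta>2 where \<delta>: "0 < \<delta>1" "0 < \<delta>2"
    "\<And>s u. s \<in> {0..T} \<Longrightarrow> u \<in> {0..T} \<Longrightarrow> dist u s < \<delta>1 \<Longrightarrow> dist (x u) (x s) < d / 2"
    "\<And>s u. s \<in> {0..T} \<Longrightarrow> u \<in> {0..T} \<Longrightarrow> dist u s < \<delta>2 \<Longrightarrow> dist (a u) (a s) < d / 2"
    using half_gt_zero[OF d(1)] unfolding uniformly_continuous_on_def by metis
  show ?thesis
  proof (rule that[of "min \<delta>1 \<delta>2"])
    fix s u y b
    assume *: "s \<in> {0..T}" "u \<in> {0..T}" "\<bar>s - u\<bar> < min \<delta>1 \<delta>2" "norm (y - x s) \<le> norm (x u - x s)"
      "norm (b - a s) \<le> norm (a u - a s)"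
    then have **: "dist y (x s) < d / 2" "dist b (a s) < d / 2"
      using \<delta>(3)[of s u] \<delta>(4)[of s u] by (auto simp: dist_norm abs_minus_commute)
    have "norm y \<le> 3 * R" "norm b \<le> 3 * S"
      using *(4,5) RS(1)[OF *(1)] RS(1)[OF *(2)] RS(2)[OF *(1)] RS(2)[OF *(2)]
        norm_triangle_ineq2[of y "x s"] norm_triangle_ineq2[of b "a s"]
        norm_triangle_ineq4[of "x u" "x s"] norm_triangle_ineq4[of "a u" "a s"] by linarith+
    moreover have "norm (x s) \<le> 3 * R" "norm (a s) \<le> 3 * S"
      using RS(1)[OF *(1)] RS(2)[OF *(1)] norm_ge_zero[of "x s"] norm_ge_zero[of "a s"] by linarith+
    ultimately have "(y, b) \<in> C" "(x s, a s) \<in> C" by (auto simp: C_def)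
    moreover have "dist (y, b) (x s, a s) < d"
      using sqrt_sum_squares_le_sum[of "dist y (x s)" "dist b (a s)"] **
      by (simp add: dist_Pair_Pair)
    ultimately show "dist (\<Phi> (y, b)) (\<Phi> (x s, a s)) < e" by (intro d(2))
  qed (use \<delta> in auto)
qed

text \<open>Mixed products are bounded by half the sum of the two squares; the double sum then
  repeats each square \<open>CARD('n)\<close> times.\<close>

lemma abs_quadratic_form_le:
  fixes h :: "real^'n"
  assumes "\<And>i j. \<bar>B i j\<bar> \<le> e"
  shows "\<bar>\<Sum>i\<in>UNIV. \<Sum>j\<in>UNIV. B i j * (h $ i * h $ j)\<bar> \<le> e * real CARD('n) * (\<Sum>i\<in>UNIV. (h $ i)\<^sup>2)"
proof -
  have "\<bar>B i j * (h $ i * h $ j)\<bar> \<le> e * (((h $ i)\<^sup>2 + (h $ j)\<^sup>2) / 2)" for i j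
  proof -
    have "\<bar>h $ i * h $ j\<bar> \<le> ((h $ i)\<^sup>2 + (h $ j)\<^sup>2) / 2"
      using sum_squares_bound[of "\<bar>h $ i\<bar>" "\<bar>h $ j\<bar>"] by (simp add: abs_mult)
    then show ?thesis
      unfolding abs_mult[of "B i j"] using assms[of i j] by (intro mult_mono) auto
  qed
  then have "\<bar>\<Sum>i\<in>UNIV. \<Sum>j\<in>UNIV. B i j * (h $ i * h $ j)\<bar> \<le>
      (\<Sum>i\<in>(UNIV::'n set). \<Sum>j\<in>(UNIV::'n set). e * (((h $ i)\<^sup>2 + (h $ j)\<^sup>2) / 2))"
    by (intro order_trans[OF sum_abs] sum_mono) auto
  also have "\<dots> = e * ((\<Sum>i\<in>UNIV. real CARD('n) * (h $ i)\<^sup>2) + (\<Sum>i\<in>(UNIV::'n set). \<Sum>j\<in>UNIV. (h $ j)\<^sup>2)) / 2"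
    by (simp add: sum_distrib_left sum.distrib add_divide_distrib sum_divide_distrib algebra_simps)
  also have "\<dots> = e * real CARD('n) * (\<Sum>i\<in>UNIV. (h $ i)\<^sup>2)"
    by (simp add: sum_distrib_left[symmetric] algebra_simps)
  finally show ?thesis .
qed

text \<open>The scale for Taylor remainders: quadratic in \<open>x\<close> and linear in
  \<open>a\<close>, so that finite quadratic variation of \<open>x\<close> and finite variation of
  \<open>a\<close> keep its sums along partitions bounded.\<close>

definition path_quadratic :: "(real \<Rightarrow> real^'d) \<Rightarrow> (real \<Rightarrow> real^'m) \<Rightarrow> real \<Rightarrow> real \<Rightarrow> real" where
  "path_quadratic x a s u = (\<Sum>i\<in>UNIV. (x u $ i - x s $ i)\<^sup>2) + (\<Sum>l\<in>UNIV. \<bar>a u $ l - a s $ l\<bar>)"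

text \<open>First \<open>x\<close> moves with \<open>a s\<close> fixed, to second order; then
  \<open>a\<close> moves with \<open>x u\<close> fixed, to first order. Replacing the coefficients
  at intermediate points by those at \<open>(x s, a s)\<close> costs little by uniform
  continuity.\<close>

lemma path_expansion:
  fixes x :: "real \<Rightarrow> real^'d" and a :: "real \<Rightarrow> real^'m"
  assumes x: "continuous_on {0..T} x" and a: "continuous_on {0..T} a"
    and G: "C21 G" and e: "0 < e"
  obtains \<delta> where "0 < \<delta>"
    "\<And>s u. \<lbrakk>0 \<le> s; s \<le> u; u \<le> T; u - s < \<delta>\<rbrakk> \<Longrightarrow>
      \<bar>G (x u, a u) - G (x s, a s) - (\<Sum>i\<in>UNIV. pd_fst i G (x s, a s) * (x u $ i - x s $ i))
        - (\<Sum>i\<in>UNIV. \<Sum>j\<in>UNIV. pd_fst j (pd_fst i G) (x s, a s) *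
             ((x u $ i - x s $ i) * (x u $ j - x s $ j))) / 2
        - (\<Sum>l\<in>UNIV. pd_snd l G (x s, a s) * (a u $ l - a s $ l))\<bar>
      \<le> e * path_quadratic x a s u"
proof -
  define N where "N = real CARD('d)"
  have N: "1 \<le> N" by (simp add: N_def Suc_leI)
  \<comment> \<open>Compensates the factor \<open>CARD('d)\<close> in
    \<open>abs_quadratic_form_le\<close>.\<close>
  define e' where "e' = e / N"
  have e': "0 < e'" "e' \<le> e" "e' * N = e"
    using N e by (auto simp: e'_def divide_le_eq mult_le_cancel_left1)
  have G': "C1_fst G" "\<And>i. C1_fst (pd_fst i G)" "C1_snd G" using G by (auto simp: C21_def)
  \<comment> \<open>Bundles all coefficients of the expansion, so that one \<delta> serves them
    all.\<close>
  define \<Phi> where "\<Phi> z = (\<chi> i j. pd_fst j (pd_fst i G) z, \<chi> l. pd_snd l G z)" for z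
  have "continuous_on UNIV \<Phi>"
    unfolding \<Phi>_def using G' by (intro continuous_intros C1_fstD C1_sndD)
  from uniform_near_path[OF x a this e'(1)] obtain \<delta> where \<delta>: "0 < \<delta>"
    "\<And>s u y b. \<lbrakk>s \<in> {0..T}; u \<in> {0..T}; \<bar>s - u\<bar> < \<delta>; norm (y - x s) \<le> norm (x u - x s);
       norm (b - a s) \<le> norm (a u - a s)\<rbrakk> \<Longrightarrow> dist (\<Phi> (y, b)) (\<Phi> (x s, a s)) < e'" by blast
  have near: "\<bar>pd_fst j (pd_fst i G) (y, b) - pd_fst j (pd_fst i G) (x s, a s)\<bar> \<le> e'"
    "\<bar>pd_snd l G (y, b) - pd_snd l G (x s, a s)\<bar> \<le> e'"
    if "s \<in> {0..T}" "u \<in> {0..T}" "\<bar>s - u\<bar> < \<delta>" "norm (y - x s) \<le> norm (x u - x s)"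
      "norm (b - a s) \<le> norm (a u - a s)" for s u y b i j l
  proof -
    have d: "dist (\<Phi> (y, b)) (\<Phi> (x s, a s)) < e'" using that by (rule \<delta>(2))
    have "dist (pd_fst j (pd_fst i G) (y, b)) (pd_fst j (pd_fst i G) (x s, a s)) =
      dist (fst (\<Phi> (y, b)) $ i $ j) (fst (\<Phi> (x s, a s)) $ i $ j)" by (simp add: \<Phi>_def)
    also have "\<dots> \<le> dist (\<Phi> (y, b)) (\<Phi> (x s, a s))"
      by (meson dist_fst_le dist_vec_nth_le order_trans)
    finally show "\<bar>pd_fst j (pd_fst i G) (y, b) - pd_fst j (pd_fst i G) (x s, a s)\<bar> \<le> e'"
      using d by (simp add: dist_real_def)
    have "dist (pd_snd l G (y, b)) (pd_snd l G (x s, a s)) =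
      dist (snd (\<Phi> (y, b)) $ l) (snd (\<Phi> (x s, a s)) $ l)" by (simp add: \<Phi>_def)
    also have "\<dots> \<le> dist (\<Phi> (y, b)) (\<Phi> (x s, a s))"
      by (meson dist_snd_le dist_vec_nth_le order_trans)
    finally show "\<bar>pd_snd l G (y, b) - pd_snd l G (x s, a s)\<bar> \<le> e'"
      using d by (simp add: dist_real_def)
  qed
  show ?thesis
  proof (rule that[OF \<delta>(1)])
    fix s u assume su: "0 \<le> s" "s \<le> u" "u \<le> T" "u - s < \<delta>"
    then have su': "s \<in> {0..T}" "u \<in> {0..T}" "\<bar>s - u\<bar> < \<delta>" by auto
    define h where "h = x u - x s"
    obtain \<tau> where \<tau>: "0 < \<tau>" "\<tau> < 1"
      "G (x s + h, a s) = G (x s, a s) + (\<Sum>i\<in>UNIV. pd_fst i G (x s, a s) * h $ i) +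
       (\<Sum>i\<in>UNIV. \<Sum>j\<in>UNIV. pd_fst j (pd_fst i G) (x s + \<tau> *\<^sub>R h, a s) * (h $ i * h $ j)) / 2"
      by (rule second_order_expansion[of "\<lambda>y. G (y, a s)" "\<lambda>i y. pd_fst i G (y, a s)"
          "\<lambda>i j y. pd_fst j (pd_fst i G) (y, a s)" "x s" h])
        (use G' in \<open>auto intro!: C1_fstD continuous_on_fst_slice\<close>)
    have "\<bar>\<Sum>i\<in>UNIV. \<Sum>j\<in>UNIV. (pd_fst j (pd_fst i G) (x s + \<tau> *\<^sub>R h, a s) -
        pd_fst j (pd_fst i G) (x s, a s)) * (h $ i * h $ j)\<bar> \<le> e' * N * (\<Sum>i\<in>UNIV. (h $ i)\<^sup>2)"
      unfolding N_def using \<tau> su'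
      by (intro abs_quadratic_form_le near(1)) (auto simp: h_def mult_left_le_one_le)
    then have 1: "\<bar>G (x u, a s) - G (x s, a s) - (\<Sum>i\<in>UNIV. pd_fst i G (x s, a s) * h $ i)
      - (\<Sum>i\<in>UNIV. \<Sum>j\<in>UNIV. pd_fst j (pd_fst i G) (x s, a s) * (h $ i * h $ j)) / 2\<bar>
      \<le> e * (\<Sum>i\<in>UNIV. (h $ i)\<^sup>2)"
      using \<tau>(3) e e'(3) sum_nonneg[of UNIV "\<lambda>i. (h $ i)\<^sup>2"] 
      by (simp add: left_diff_distrib sum_subtractf) (simp add: h_def)
    have "\<bar>G (x u, a s + (a u - a s)) - G (x u, a s) -
        (\<Sum>l\<in>UNIV. pd_snd l G (x s, a s) * (a u - a s) $ l)\<bar> \<le> e' * (\<Sum>l\<in>UNIV. \<bar>(a u - a s) $ l\<bar>)"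
    proof (rule coordinate_linearization[where f = "\<lambda>b. G (x u, b)" and f' = "\<lambda>l b. pd_snd l G (x u, b)"])
      fix l b assume b: "\<And>k. \<bar>b $ k - a s $ k\<bar> \<le> \<bar>(a u - a s) $ k\<bar>"
      have "norm (b - a s) \<le> norm (a u - a s)"
        by (rule norm_le_componentwise_cart) (use b in simp)
      then show "\<bar>pd_snd l G (x u, b) - pd_snd l G (x s, a s)\<bar> \<le> e'"
        using su' by (intro near(2)) auto
    qed (rule C1_sndD[OF G'(3)])
    also have "\<dots> \<le> e * (\<Sum>l\<in>UNIV. \<bar>(a u - a s) $ l\<bar>)"
      using e' by (intro mult_right_mono sum_nonneg) auto
    finally have 2: "\<bar>G (x u, a u) - G (x u, a s) - (\<Sum>l\<in>UNIV. pd_snd l G (x s, a s) * (a u - a s) $ l)\<bar>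
      \<le> e * (\<Sum>l\<in>UNIV. \<bar>(a u - a s) $ l\<bar>)" by simp
    from 1 2 show "\<bar>G (x u, a u) - G (x s, a s) - (\<Sum>i\<in>UNIV. pd_fst i G (x s, a s) * (x u $ i - x s $ i))
        - (\<Sum>i\<in>UNIV. \<Sum>j\<in>UNIV. pd_fst j (pd_fst i G) (x s, a s) *
             ((x u $ i - x s $ i) * (x u $ j - x s $ j))) / 2
        - (\<Sum>l\<in>UNIV. pd_snd l G (x s, a s) * (a u $ l - a s $ l))\<bar>
      \<le> e * path_quadratic x a s u"
      unfolding path_quadratic_def distrib_left h_def vector_minus_component by linarith
  qed
qed

text \<open>\<open>C21\<close> provides continuity of the partial derivatives only;
  \<open>coordinate_linearization\<close> in each block of variables turns this into continuity of
  \<open>G\<close> itself.\<close>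

lemma C21_continuous:
  fixes G :: "(real^'d) \<times> (real^'m) \<Rightarrow> real"
  assumes G: "C21 G"
  shows "continuous_on UNIV G"
proof -
  have G': "C1_fst G" "C1_snd G" using G by (auto simp: C21_def)
  have "isCont G z" for z
  proof -
    obtain x a where z: "z = (x, a)" by (cases z)
    have cont: "(pd_fst i G \<longlongrightarrow> pd_fst i G z) (nhds z)" "(pd_snd l G \<longlongrightarrow> pd_snd l G z) (nhds z)" for i l
      using C1_fstD(2)[OF G'(1), of i] C1_sndD(2)[OF G'(2), of l]
      by (auto simp: continuous_on_eq_continuous_at isCont_def tendsto_at_iff_tendsto_nhds z)
    have "eventually (\<lambda>w. (\<forall>i. dist (pd_fst i G w) (pd_fst i G z) < 1) \<and>
        (\<forall>l. dist (pd_snd l G w) (pd_snd l G z) < 1)) (nhds z)"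
      by (intro eventually_conj eventually_all_finite tendstoD[OF cont(1)] tendstoD[OF cont(2)]) auto
    then obtain d where d: "0 < d"
      "\<And>w i. dist w z < d \<Longrightarrow> dist (pd_fst i G w) (pd_fst i G z) < 1"
      "\<And>w l. dist w z < d \<Longrightarrow> dist (pd_snd l G w) (pd_snd l G z) < 1"
      by (auto simp: eventually_nhds_metric)
    \<comment> \<open>Near \<open>z\<close> the partial derivatives are within 1 of their values at
      \<open>z\<close>. \<open>B\<close> collects the linear terms and the resulting errors for both
      blocks, and tends to 0 at \<open>z\<close>.\<close>
    define B where "B w = \<bar>\<Sum>i\<in>UNIV. pd_fst i G z * (fst w - x) $ i\<bar> + (\<Sum>i\<in>UNIV. \<bar>(fst w - x) $ i\<bar>) +
      (\<bar>\<Sum>l\<in>UNIV. pd_snd l G z * (snd w - a) $ l\<bar> + (\<Sum>l\<in>UNIV. \<bar>(snd w - a) $ l\<bar>))" for w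
    have "eventually (\<lambda>w. dist w z < d / 2) (at z)"
      using tendstoD[OF tendsto_ident_at half_gt_zero[OF d(1)]] .
    then have "eventually (\<lambda>w. norm (G w - G z) \<le> B w) (at z)"
    proof eventually_elim
      case (elim w)
      have n: "norm (fst w - x) < d / 2" "norm (snd w - a) < d / 2"
        using dist_fst_le[of w z] dist_snd_le[of w z] elim by (auto simp: dist_norm z)
      have close: "dist (y, b) z < d" if "norm (y - x) \<le> norm (fst w - x)" "norm (b - a) \<le> norm (snd w - a)" for y b
        using sqrt_sum_squares_le_sum[of "dist y x" "dist b a"] that n
        by (simp add: z dist_norm norm_Pair)
      have "\<bar>G (x + (fst w - x), snd w) - G (x, snd w) - (\<Sum>i\<in>UNIV. pd_fst i G z * (fst w - x) $ i)\<bar>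
        \<le> 1 * (\<Sum>i\<in>UNIV. \<bar>(fst w - x) $ i\<bar>)"
      proof (rule coordinate_linearization[where f = "\<lambda>y. G (y, snd w)"])
        show "((\<lambda>\<tau>. G (y + \<tau> *\<^sub>R axis i 1, snd w)) has_real_derivative pd_fst i G (y, snd w)) (at 0)" for i y
          by (rule C1_fstD[OF G'(1)])
        fix i y assume y: "\<And>k. \<bar>y $ k - x $ k\<bar> \<le> \<bar>(fst w - x) $ k\<bar>"
        have "norm (y - x) \<le> norm (fst w - x)"
          by (rule norm_le_componentwise_cart) (use y in simp)
        then show "\<bar>pd_fst i G (y, snd w) - pd_fst i G z\<bar> \<le> 1"
          using d(2)[OF close, of y "snd w" i] by (simp add: dist_real_def)
      qed
      moreover have "\<bar>G (x, a + (snd w - a)) - G (x, a) - (\<Sum>l\<in>UNIV. pd_snd l G z * (snd w - a) $ l)\<bar>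
        \<le> 1 * (\<Sum>l\<in>UNIV. \<bar>(snd w - a) $ l\<bar>)"
      proof (rule coordinate_linearization[where f = "\<lambda>b. G (x, b)"])
        show "((\<lambda>\<tau>. G (x, b + \<tau> *\<^sub>R axis l 1)) has_real_derivative pd_snd l G (x, b)) (at 0)" for l b
          by (rule C1_sndD[OF G'(2)])
        fix l b assume b: "\<And>k. \<bar>b $ k - a $ k\<bar> \<le> \<bar>(snd w - a) $ k\<bar>"
        have "norm (b - a) \<le> norm (snd w - a)"
          by (rule norm_le_componentwise_cart) (use b in simp)
        then show "\<bar>pd_snd l G (x, b) - pd_snd l G z\<bar> \<le> 1"
          using d(3)[OF close, of x b l] by (simp add: dist_real_def)
      qed
      ultimately show ?case by (simp add: B_def z)
    qed
    moreover have "(B \<longlongrightarrow> B z) (at z)"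
      unfolding B_def by (intro tendsto_intros)
    then have "(B \<longlongrightarrow> 0) (at z)" by (simp add: B_def z)
    ultimately have "((\<lambda>w. G w - G z) \<longlongrightarrow> 0) (at z)" by (rule Lim_null_comparison)
    then show "isCont G z" unfolding isCont_def by (rule LIM_zero_cancel)
  qed
  then show ?thesis by (simp add: continuous_at_imp_continuous_on)
qed

section \<open>The pathwise Ito formula\<close>

text \<open>The nonzero stopped cells are cells of the finite set made of \<open>t\<close> and the
  points of \<open>P\<close> below \<open>t\<close>, and the sum over that set competes in the
  supremum.\<close>

lemma partition_sum_norm_le_variation:
  assumes P: "partition_of T P" and t: "t \<in> {0..T}"
    and bv: "bdd_above (variation_sums g 0 T)"
  shows "partition_sum P (\<lambda>s u. norm (g u - g s)) t \<le> total_variation g 0 T"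
proof -
  define P' where "P' = insert t {p \<in> P. p < t}"
  define C where "C = {(s, u) \<in> consecutive P. s < t}"
  have P': "finite P'" "P' \<subseteq> {0..T}" using partition_ofD[OF P] t by (auto simp: P'_def)
  have fin: "finite C" unfolding C_def using partition_ofD(1)[OF P]
    by (auto intro: finite_subset[OF _ finite_consecutive])
  have "s < t" if "(s, u) \<in> consecutive P" "g (min u t) \<noteq> g (min s t)" for s u
    using consecutiveD(3)[OF that(1)] that(2) by (cases "s < t") auto
  then have "partition_sum P (\<lambda>s u. norm (g u - g s)) t = (\<Sum>(s, u)\<in>C. norm (g (min u t) - g s))"
    unfolding partition_sum_def C_def using partition_ofD(1)[OF P]
    by (intro sum.mono_neutral_cong_right) (auto simp: min_absorb1)
  also have "\<dots> = (\<Sum>(s, u)\<in>(\<lambda>(s, u). (s, min u t)) ` C. norm (g u - g s))"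
  proof (subst sum.reindex)
    show "inj_on (\<lambda>(s, u). (s, min u t)) C"
    proof -
      have "u = u'" if "(s, u) \<in> consecutive P" "(s, u') \<in> consecutive P" for s u u'
        using consecutiveD(4)[OF that(1) consecutiveD(2)[OF that(2)]] consecutiveD(3)[OF that(1)]
          consecutiveD(4)[OF that(2) consecutiveD(2)[OF that(1)]] consecutiveD(3)[OF that(2)] by linarith
      then show ?thesis by (auto simp: inj_on_def C_def)
    qed
  qed (auto intro!: sum.cong)
  also have "\<dots> \<le> (\<Sum>(s, u)\<in>consecutive P'. norm (g u - g s))"
  proof (rule sum_mono2)
    show "(\<lambda>(s, u). (s, min u t)) ` C \<subseteq> consecutive P'"
      by (auto simp: C_def consecutive_iff P'_def min_def not_le)
        (metis order_less_trans order_less_irrefl order_le_less_trans)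
  qed (use P' in auto)
  also have "\<dots> \<le> total_variation g 0 T"
    unfolding total_variation_def
    by (rule cSup_upper[OF _ bv]) (use P' in \<open>auto simp: variation_sums_def\<close>)
  finally show ?thesis .
qed

lemma continuous_bounded_real:
  fixes f :: "real \<Rightarrow> real"
  assumes "continuous_on {0..T} f"
  obtains C where "\<And>t. t \<in> {0..T} \<Longrightarrow> \<bar>f t\<bar> \<le> C"
proof -
  have "bounded (f ` {0..T})"
    using assms by (intro compact_imp_bounded compact_continuous_image) auto
  then show ?thesis using that by (auto simp only: bounded_iff real_norm_def ball_simps)
qed

section \<open>Discrete defects along the path and their limit\<close>

locale regular_path =
  fixes T :: real and \<pi> :: "nat \<Rightarrow> real set" and \<mu> :: "real \<Rightarrow> real^'d"
    and A :: "real \<Rightarrow> real^'m" and G :: "(real^'d) \<times> (real^'m) \<Rightarrow> real"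
  assumes T_pos: "0 < T"
    and partitions: "refining_partitions T \<pi>"
    and \<mu>_cont: "continuous_on {0..T} \<mu>"
    and covariations: "has_covariations T \<pi> \<mu>"
    and A_CBV: "CBV T A"
    and G_C21: "C21 G"
begin

abbreviation g :: "real \<Rightarrow> real" where "g t \<equiv> G (\<mu> t, A t)"

text \<open>The discrete increment of \<open>Gam\<close> over one cell: by \<open>Gam_limit\<close>
  the sums of \<open>defect\<close> along the partitions converge to \<open>Gam\<close>.\<close>

definition defect :: "real \<Rightarrow> real \<Rightarrow> real" where
  "defect s u = (\<Sum>i\<in>UNIV. pd_fst i G (\<mu> s, A s) * (\<mu> u $ i - \<mu> s $ i)) - (g u - g s)"

lemmas part = refining_partitionsD(1)[OF partitions]

lemma A_cont: "continuous_on {0..T} A"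
  using A_CBV by (simp add: CBV_def)

lemma path_cont: "continuous_on UNIV F \<Longrightarrow> continuous_on {0..T} (\<lambda>t. F (\<mu> t, A t))"
  by (rule continuous_on_compose2[of UNIV F]) (auto intro!: continuous_intros \<mu>_cont A_cont)

lemma g_cont: "continuous_on {0..T} g"
  by (rule path_cont) (rule C21_continuous[OF G_C21])

lemma covariation_limit:
  obtains W where "continuous_on {0..T} W"
    "\<And>t. t \<in> {0..T} \<Longrightarrow>
      (\<lambda>n. partition_sum (\<pi> n) (\<lambda>s u. (\<mu> u $ i - \<mu> s $ i) * (\<mu> u $ k - \<mu> s $ k)) t) \<longlonglongrightarrow> W t"
proof -
  have eq: "covariation_sum (\<pi> n) \<mu> i k t =
      partition_sum (\<pi> n) (\<lambda>s u. (\<mu> u $ i - \<mu> s $ i) * (\<mu> u $ k - \<mu> s $ k)) t" for n t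
    unfolding covariation_sum_def
    by (rule partition_sum_alt) (auto simp: partition_ofD(1)[OF part])
  have "continuous_on {0..T} (\<lambda>t. lim (\<lambda>n. covariation_sum (\<pi> n) \<mu> i k t))"
    "t \<in> {0..T} \<Longrightarrow> (\<lambda>n. covariation_sum (\<pi> n) \<mu> i k t) \<longlonglongrightarrow>
      lim (\<lambda>n. covariation_sum (\<pi> n) \<mu> i k t)" for t
    using covariations by (simp_all add: has_covariations_def convergent_LIMSEQ_iff)
  then show ?thesis unfolding eq by (rule that)
qed

text \<open>The quadratic part converges to a continuous, hence bounded, function of
  \<open>t\<close>, and the other part is at most the total variation of \<open>A\<close> once per
  coordinate. \<open>K\<close> is the same for all \<open>t\<close>; the index from which the bound
  holds may vary.\<close>

lemma path_quadratic_bound: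
  obtains K where "0 \<le> K" "\<And>t. t \<in> {0..T} \<Longrightarrow>
    eventually (\<lambda>n. partition_sum (\<pi> n) (path_quadratic \<mu> A) t \<le> K) sequentially"
proof -
  have "\<exists>W. continuous_on {0..T} W \<and> (\<forall>t\<in>{0..T}.
      (\<lambda>n. partition_sum (\<pi> n) (\<lambda>s u. (\<mu> u $ i - \<mu> s $ i)\<^sup>2) t) \<longlonglongrightarrow> W t)" for i
    by (rule covariation_limit[of i i], rule exI) (auto simp: power2_eq_square)
  then obtain W where W: "\<And>i. continuous_on {0..T} (W i)"
    "\<And>i t. t \<in> {0..T} \<Longrightarrow> (\<lambda>n. partition_sum (\<pi> n) (\<lambda>s u. (\<mu> u $ i - \<mu> s $ i)\<^sup>2) t) \<longlonglongrightarrow> W i t"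
    by metis
  have "continuous_on {0..T} (\<lambda>t. \<Sum>i\<in>UNIV. W i t)"
    by (intro continuous_intros W)
  then obtain K1 where K1: "\<And>t. t \<in> {0..T} \<Longrightarrow> \<bar>\<Sum>i\<in>UNIV. W i t\<bar> \<le> K1"
    by (rule continuous_bounded_real) (rule that)
  have bv: "bdd_above (variation_sums A 0 T)"
    using A_CBV by (simp add: CBV_def bounded_variation_on_def)
  define K2 where "K2 = (\<Sum>l\<in>(UNIV::'m set). total_variation A 0 T)"
  have A: "partition_sum (\<pi> n) (\<lambda>s u. \<Sum>l\<in>UNIV. \<bar>A u $ l - A s $ l\<bar>) t \<le> K2" if t: "t \<in> {0..T}" for n t
    unfolding partition_sum_sum K2_def
  proof (rule sum_mono)
    fix l
    have "partition_sum (\<pi> n) (\<lambda>s u. \<bar>A u $ l - A s $ l\<bar>) t \<le> partition_sum (\<pi> n) (\<lambda>s u. norm (A u - A s)) t"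
      by (rule partition_sum_mono) (metis component_le_norm_cart vector_minus_component)
    also have "\<dots> \<le> total_variation A 0 T" by (rule partition_sum_norm_le_variation[OF part t bv])
    finally show "partition_sum (\<pi> n) (\<lambda>s u. \<bar>A u $ l - A s $ l\<bar>) t \<le> total_variation A 0 T" .
  qed
  have "eventually (\<lambda>n. partition_sum (\<pi> n) (path_quadratic \<mu> A) t \<le> \<bar>K1\<bar> + 1 + \<bar>K2\<bar>) sequentially"
    if t: "t \<in> {0..T}" for t
  proof -
    have "(\<lambda>n. partition_sum (\<pi> n) (\<lambda>s u. \<Sum>i\<in>UNIV. (\<mu> u $ i - \<mu> s $ i)\<^sup>2) t) \<longlonglongrightarrow> (\<Sum>i\<in>UNIV. W i t)"
      unfolding partition_sum_sum by (intro tendsto_sum W(2) t)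
    moreover have "(\<Sum>i\<in>UNIV. W i t) < \<bar>K1\<bar> + 1" using K1[OF t] by linarith
    ultimately have "eventually (\<lambda>n. partition_sum (\<pi> n) (\<lambda>s u. \<Sum>i\<in>UNIV. (\<mu> u $ i - \<mu> s $ i)\<^sup>2) t < \<bar>K1\<bar> + 1) sequentially"
      by (rule order_tendstoD)
    then show ?thesis
    proof eventually_elim
      case (elim n)
      then show ?case
        using A[OF t, of n] unfolding path_quadratic_def partition_sum_add by linarith
    qed
  qed
  then show ?thesis by (intro that[of "\<bar>K1\<bar> + 1 + \<bar>K2\<bar>"]) auto
qed

lemma path_quadratic_self [simp]: "path_quadratic \<mu> A s s = 0"
  by (simp add: path_quadratic_def)

lemma abs_le_path_quadratic:
  "\<bar>(\<mu> u $ i - \<mu> s $ i) * (\<mu> u $ k - \<mu> s $ k)\<bar> \<le> path_quadratic \<mu> A s u"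
  "\<bar>A u $ l - A s $ l\<bar> \<le> path_quadratic \<mu> A s u"
  "0 \<le> path_quadratic \<mu> A s u"
proof -
  have *: "0 \<le> (\<Sum>l\<in>UNIV. \<bar>A u $ l - A s $ l\<bar>)" "0 \<le> (\<Sum>i\<in>UNIV. (\<mu> u $ i - \<mu> s $ i)\<^sup>2)"
    by (intro sum_nonneg; simp)+
  have **: "(\<mu> u $ j - \<mu> s $ j)\<^sup>2 \<le> (\<Sum>i\<in>UNIV. (\<mu> u $ i - \<mu> s $ i)\<^sup>2)" for j
    by (rule member_le_sum) auto
  have "\<bar>(\<mu> u $ i - \<mu> s $ i) * (\<mu> u $ k - \<mu> s $ k)\<bar> \<le> ((\<mu> u $ i - \<mu> s $ i)\<^sup>2 + (\<mu> u $ k - \<mu> s $ k)\<^sup>2) / 2"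
    using sum_squares_bound[of "\<bar>\<mu> u $ i - \<mu> s $ i\<bar>" "\<bar>\<mu> u $ k - \<mu> s $ k\<bar>"] by (simp add: abs_mult)
  then show "\<bar>(\<mu> u $ i - \<mu> s $ i) * (\<mu> u $ k - \<mu> s $ k)\<bar> \<le> path_quadratic \<mu> A s u"
    using * **[of i] **[of k] unfolding path_quadratic_def by argo
  have "\<bar>A u $ l - A s $ l\<bar> \<le> (\<Sum>l\<in>UNIV. \<bar>A u $ l - A s $ l\<bar>)"
    by (rule member_le_sum) auto
  then show "\<bar>A u $ l - A s $ l\<bar> \<le> path_quadratic \<mu> A s u" "0 \<le> path_quadratic \<mu> A s u"
    using * unfolding path_quadratic_def by linarith+
qed

text \<open>Domination by \<open>path_quadratic\<close> supplies both \<open>D x x = 0\<close> and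
  the bound on absolute sums that \<open>weighted_partition_sum_limit\<close> asks for.\<close>

lemma dominated_limit:
  assumes D: "\<And>s u. \<bar>D s u\<bar> \<le> path_quadratic \<mu> A s u"
    and W: "\<And>t. t \<in> {0..T} \<Longrightarrow> (\<lambda>n. partition_sum (\<pi> n) D t) \<longlonglongrightarrow> W t"
    and cont: "continuous_on {0..T} W" "continuous_on {0..T} f"
  shows "\<exists>J. continuous_on {0..T} J \<and>
    (\<forall>t\<in>{0..T}. (\<lambda>n. partition_sum (\<pi> n) (\<lambda>s u. f s * D s u) t) \<longlonglongrightarrow> J t)"
proof -
  obtain K where K: "\<And>t. t \<in> {0..T} \<Longrightarrow>
    eventually (\<lambda>n. partition_sum (\<pi> n) (path_quadratic \<mu> A) t \<le> K) sequentially"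
    using path_quadratic_bound by blast
  have bound: "eventually (\<lambda>n. partition_sum (\<pi> n) (\<lambda>s u. \<bar>D s u\<bar>) t \<le> K) sequentially"
    if "t \<in> {0..T}" for t
    using K[OF that] by (rule eventually_mono) (erule order_trans[rotated], rule partition_sum_mono, rule D)
  have self: "D x x = 0" for x using D[of x x] by simp
  obtain J where J:
    "\<And>t. t \<in> {0..T} \<Longrightarrow> (\<lambda>n. partition_sum (\<pi> n) (\<lambda>s u. f s * D s u) t) \<longlonglongrightarrow> J t"
    "uniform_limit {0..T} (\<lambda>m. partition_sum (\<pi> m) (\<lambda>s u. f s * (W u - W s))) J sequentially"
    by (rule weighted_partition_sum_limit[OF partitions self W bound cont(2)]) (assumption | rule that)+
  show ?thesis
    using J(1) weighted_partition_sum_limit_continuous[OF partitions cont(2,1) J(2)] by blast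
qed

lemma defect_self [simp]: "defect s s = 0"
  by (simp add: defect_def)

text \<open>The Ito correction with coefficients at the left endpoint; \<open>defect\<close> equals
  its negative up to a Taylor remainder.\<close>

definition second_order_part :: "real \<Rightarrow> real \<Rightarrow> real" where
  "second_order_part s u =
     (\<Sum>i\<in>UNIV. \<Sum>j\<in>UNIV. pd_fst j (pd_fst i G) (\<mu> s, A s) *
        ((\<mu> u $ i - \<mu> s $ i) * (\<mu> u $ j - \<mu> s $ j))) / 2 +
     (\<Sum>l\<in>UNIV. pd_snd l G (\<mu> s, A s) * (A u $ l - A s $ l))"

lemma defect_expansion:
  assumes "0 < e"
  obtains \<delta> where "0 < \<delta>"
    "\<And>s u. \<lbrakk>0 \<le> s; s \<le> u; u \<le> T; u - s < \<delta>\<rbrakk> \<Longrightarrow>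
      \<bar>defect s u + second_order_part s u\<bar> \<le> e * path_quadratic \<mu> A s u"
proof (rule path_expansion[OF \<mu>_cont A_cont G_C21 assms])
  fix \<delta> :: real
  assume *: "0 < \<delta>" and exp: "\<And>s u. \<lbrakk>0 \<le> s; s \<le> u; u \<le> T; u - s < \<delta>\<rbrakk> \<Longrightarrow>
      \<bar>g u - g s - (\<Sum>i\<in>UNIV. pd_fst i G (\<mu> s, A s) * (\<mu> u $ i - \<mu> s $ i))
        - (\<Sum>i\<in>UNIV. \<Sum>j\<in>UNIV. pd_fst j (pd_fst i G) (\<mu> s, A s) *
             ((\<mu> u $ i - \<mu> s $ i) * (\<mu> u $ j - \<mu> s $ j))) / 2
        - (\<Sum>l\<in>UNIV. pd_snd l G (\<mu> s, A s) * (A u $ l - A s $ l))\<bar>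
      \<le> e * path_quadratic \<mu> A s u"
  show ?thesis
  proof (rule that[OF *])
    fix s u assume "0 \<le> s" "s \<le> u" "u \<le> T" "u - s < \<delta>"
    from exp[OF this] show "\<bar>defect s u + second_order_part s u\<bar> \<le> e * path_quadratic \<mu> A s u"
      unfolding defect_def second_order_part_def by linarith
  qed
qed

text \<open>Every summand is a continuous coefficient times an increment dominated by
  \<open>path_quadratic\<close>. The unweighted sums converge to the covariations or, for the
  increments of \<open>A\<close>, telescope.\<close>

lemma second_order_part_limit:
  obtains J where "continuous_on {0..T} J"
    "\<And>t. t \<in> {0..T} \<Longrightarrow> (\<lambda>n. partition_sum (\<pi> n) second_order_part t) \<longlonglongrightarrow> J t"
proof -
  have G': "C1_fst G" "\<And>i. C1_fst (pd_fst i G)" "C1_snd G" using G_C21 by (auto simp: C21_def)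
  have "\<exists>J. continuous_on {0..T} J \<and> (\<forall>t\<in>{0..T}.
    (\<lambda>n. partition_sum (\<pi> n) (\<lambda>s u. pd_fst j (pd_fst i G) (\<mu> s, A s) *
        ((\<mu> u $ i - \<mu> s $ i) * (\<mu> u $ j - \<mu> s $ j))) t) \<longlonglongrightarrow> J t)" for i j
  proof (rule covariation_limit[of i j])
    fix W assume W: "continuous_on {0..T} W"
      "\<And>t. t \<in> {0..T} \<Longrightarrow> (\<lambda>n. partition_sum (\<pi> n)
         (\<lambda>s u. (\<mu> u $ i - \<mu> s $ i) * (\<mu> u $ j - \<mu> s $ j)) t) \<longlonglongrightarrow> W t"
    show ?thesis
      by (rule dominated_limit[OF abs_le_path_quadratic(1) W(2,1)
            path_cont[OF C1_fstD(2)[OF G'(2)[of i], of j]]])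
  qed
  then have "\<forall>i j. \<exists>J. continuous_on {0..T} J \<and> (\<forall>t\<in>{0..T}.
    (\<lambda>n. partition_sum (\<pi> n) (\<lambda>s u. pd_fst j (pd_fst i G) (\<mu> s, A s) *
        ((\<mu> u $ i - \<mu> s $ i) * (\<mu> u $ j - \<mu> s $ j))) t) \<longlonglongrightarrow> J t)" by blast
  then obtain J1 where J1: "\<And>i j. continuous_on {0..T} (J1 i j)"
    "\<And>i j t. t \<in> {0..T} \<Longrightarrow> (\<lambda>n. partition_sum (\<pi> n) (\<lambda>s u. pd_fst j (pd_fst i G) (\<mu> s, A s) *
        ((\<mu> u $ i - \<mu> s $ i) * (\<mu> u $ j - \<mu> s $ j))) t) \<longlonglongrightarrow> J1 i j t"
    unfolding choice_iff by blast
  have "\<exists>J. continuous_on {0..T} J \<and> (\<forall>t\<in>{0..T}.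
    (\<lambda>n. partition_sum (\<pi> n) (\<lambda>s u. pd_snd l G (\<mu> s, A s) * (A u $ l - A s $ l)) t) \<longlonglongrightarrow> J t)" for l
  proof -
    have "(\<lambda>n. partition_sum (\<pi> n) (\<lambda>s u. A u $ l - A s $ l) t) \<longlonglongrightarrow> A t $ l - A 0 $ l"
      if "t \<in> {0..T}" for t
      using partition_sum_telescope[OF part that, of _ "\<lambda>t. A t $ l"] by simp
    moreover have "continuous_on {0..T} (\<lambda>t. A t $ l - A 0 $ l)"
      by (intro continuous_intros A_cont)
    ultimately show ?thesis
      by (rule dominated_limit[OF abs_le_path_quadratic(2) _ _ path_cont[OF C1_sndD(2)[OF G'(3), of l]]])
  qed
  then have "\<forall>l. \<exists>J. continuous_on {0..T} J \<and> (\<forall>t\<in>{0..T}.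
    (\<lambda>n. partition_sum (\<pi> n) (\<lambda>s u. pd_snd l G (\<mu> s, A s) * (A u $ l - A s $ l)) t) \<longlonglongrightarrow> J t)"
    by blast
  then obtain J2 where J2: "\<And>l. continuous_on {0..T} (J2 l)"
    "\<And>l t. t \<in> {0..T} \<Longrightarrow> (\<lambda>n. partition_sum (\<pi> n) (\<lambda>s u. pd_snd l G (\<mu> s, A s) * (A u $ l - A s $ l)) t)
        \<longlonglongrightarrow> J2 l t" unfolding choice_iff by blast
  define J where "J t = 1 / 2 * (\<Sum>i\<in>UNIV. \<Sum>j\<in>UNIV. J1 i j t) + (\<Sum>l\<in>UNIV. J2 l t)" for t
  have eq: "second_order_part = (\<lambda>s u. 1 / 2 * (\<Sum>i\<in>UNIV. \<Sum>j\<in>UNIV. pd_fst j (pd_fst i G) (\<mu> s, A s) *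
        ((\<mu> u $ i - \<mu> s $ i) * (\<mu> u $ j - \<mu> s $ j))) +
     (\<Sum>l\<in>UNIV. pd_snd l G (\<mu> s, A s) * (A u $ l - A s $ l)))"
    by (simp add: second_order_part_def fun_eq_iff)
  show ?thesis
  proof (rule that[of J])
    show "continuous_on {0..T} J" unfolding J_def by (intro continuous_intros J1 J2)
    show "(\<lambda>n. partition_sum (\<pi> n) second_order_part t) \<longlonglongrightarrow> J t" if "t \<in> {0..T}" for t
      unfolding eq partition_sum_add partition_sum_cmult partition_sum_sum J_def
      by (intro tendsto_intros J1 J2 that)
  qed
qed

lemma pathwise_integral_alt:
  "pathwise_integral \<pi> \<theta> \<mu> t =
     lim (\<lambda>n. partition_sum (\<pi> n) (\<lambda>s u. \<Sum>i\<in>UNIV. \<theta> s $ i * (\<mu> u $ i - \<mu> s $ i)) t)"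
  unfolding pathwise_integral_def
  by (subst partition_sum_alt) (auto simp: partition_ofD(1)[OF part])

text \<open>The sums of \<open>defect + second_order_part\<close> vanish in the limit, so those of
  \<open>defect\<close> converge to \<open>- J\<close> with \<open>J\<close> continuous. This also
  shows that the limit behind \<open>pathwise_integral\<close> exists, which identifies
  \<open>Gam\<close> with \<open>- J\<close>.\<close>

lemma Gam_limit:
  shows "continuous_on {0..T} (Gam \<pi> G \<mu> A)"
    and "t \<in> {0..T} \<Longrightarrow> (\<lambda>n. partition_sum (\<pi> n) defect t) \<longlonglongrightarrow> Gam \<pi> G \<mu> A t"
proof -
  obtain J where J: "continuous_on {0..T} J"
    "\<And>t. t \<in> {0..T} \<Longrightarrow> (\<lambda>n. partition_sum (\<pi> n) second_order_part t) \<longlonglongrightarrow> J t"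
    using second_order_part_limit by blast
  obtain K where K: "0 \<le> K" "\<And>t. t \<in> {0..T} \<Longrightarrow>
    eventually (\<lambda>n. partition_sum (\<pi> n) (path_quadratic \<mu> A) t \<le> K) sequentially"
    using path_quadratic_bound by blast
  have lim: "(\<lambda>n. partition_sum (\<pi> n) defect t) \<longlonglongrightarrow> - J t" if t: "t \<in> {0..T}" for t
  proof -
    have "(\<lambda>n. partition_sum (\<pi> n) (\<lambda>s u. defect s u + second_order_part s u) t) \<longlonglongrightarrow> 0"
    proof (rule tendstoI)
      fix e :: real assume "0 < e"
      define e' where "e' = e / (K + 1)"
      have e': "0 < e'" using \<open>0 < e\<close> K(1) by (simp add: e'_def)
      have "e' * K < e" using \<open>0 < e\<close> K(1) by (simp add: e'_def divide_simps)
      obtain \<delta> where \<delta>: "0 < \<delta>" "\<And>s u. \<lbrakk>0 \<le> s; s \<le> u; u \<le> T; u - s < \<delta>\<rbrakk> \<Longrightarrow>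
          \<bar>defect s u + second_order_part s u\<bar> \<le> e' * path_quadratic \<mu> A s u"
        using defect_expansion[OF e'] by blast
      show "eventually (\<lambda>n. dist (partition_sum (\<pi> n) (\<lambda>s u. defect s u + second_order_part s u) t) 0 < e) sequentially"
        using refining_partitionsD(3)[OF partitions \<delta>(1)] K(2)[OF t]
      proof eventually_elim
        case (elim n)
        have "\<bar>partition_sum (\<pi> n) (\<lambda>s u. defect s u + second_order_part s u) t\<bar>
            \<le> e' * partition_sum (\<pi> n) (path_quadratic \<mu> A) t"
          unfolding partition_sum_cmult[symmetric]
          by (rule abs_partition_sum_le_fine[OF part elim(1) t \<delta>(2)])
        also have "\<dots> \<le> e' * K" using elim(2) e' by (intro mult_left_mono) auto
        finally show ?case using \<open>e' * K < e\<close> by simp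
      qed
    qed
    from tendsto_diff[OF this J(2)[OF t]] show ?thesis by (simp add: partition_sum_add)
  qed
  have Gam: "Gam \<pi> G \<mu> A t = - J t" if t: "t \<in> {0..T}" for t
  proof -
    \<comment> \<open>Adding the telescoping increments of \<open>g\<close> back to
      \<open>defect\<close> leaves exactly the Riemann sums of the gradient.\<close>
    have "(\<lambda>n. partition_sum (\<pi> n) (\<lambda>s u. defect s u + (g u - g s)) t) \<longlonglongrightarrow> - J t + (g t - g 0)"
      unfolding partition_sum_add using partition_sum_telescope[OF part t, of _ g]
      by (intro tendsto_intros lim t) simp
    then have "pathwise_integral \<pi> (\<lambda>s. grad_fst G (\<mu> s, A s)) \<mu> t = - J t + (g t - g 0)"
      unfolding pathwise_integral_alt by (intro limI) (simp add: defect_def grad_fst_def)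
    then show ?thesis by (simp add: Gam_def)
  qed
  show "continuous_on {0..T} (Gam \<pi> G \<mu> A)"
    using continuous_on_minus[OF J(1)] by (rule continuous_on_eq) (simp add: Gam)
  show "t \<in> {0..T} \<Longrightarrow> (\<lambda>n. partition_sum (\<pi> n) defect t) \<longlonglongrightarrow> Gam \<pi> G \<mu> A t"
    using lim Gam by simp
qed

text \<open>Up to a remainder of at most \<open>path_quadratic\<close>, \<open>defect\<close> is the
  negative of \<open>second_order_part\<close>, whose coefficients are bounded along the path. This
  is the bound needed for weighting \<open>defect\<close> by the exponential factor.\<close>

lemma defect_bound:
  obtains K where "\<And>t. t \<in> {0..T} \<Longrightarrow>
    eventually (\<lambda>n. partition_sum (\<pi> n) (\<lambda>s u. \<bar>defect s u\<bar>) t \<le> K) sequentially"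
proof -
  have G': "C1_fst G" "\<And>i. C1_fst (pd_fst i G)" "C1_snd G" using G_C21 by (auto simp: C21_def)
  define c where "c s = (\<Sum>i\<in>UNIV. \<Sum>j\<in>UNIV. \<bar>pd_fst j (pd_fst i G) (\<mu> s, A s)\<bar>) / 2 +
    (\<Sum>l\<in>UNIV. \<bar>pd_snd l G (\<mu> s, A s)\<bar>)" for s
  have "continuous_on {0..T} c"
    unfolding c_def by (intro continuous_intros path_cont C1_fstD C1_sndD G') auto
  then obtain C where C: "\<And>t. t \<in> {0..T} \<Longrightarrow> \<bar>c t\<bar> \<le> C"
    by (rule continuous_bounded_real) (rule that)
  have so: "\<bar>second_order_part s u\<bar> \<le> c s * path_quadratic \<mu> A s u" for s u
  proof -
    define q where "q = path_quadratic \<mu> A s u"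
    have "\<bar>\<Sum>i\<in>UNIV. \<Sum>j\<in>UNIV. pd_fst j (pd_fst i G) (\<mu> s, A s) *
        ((\<mu> u $ i - \<mu> s $ i) * (\<mu> u $ j - \<mu> s $ j))\<bar> \<le>
        (\<Sum>i\<in>UNIV. \<Sum>j\<in>UNIV. \<bar>pd_fst j (pd_fst i G) (\<mu> s, A s)\<bar> * q)"
      unfolding q_def
      by (intro order_trans[OF sum_abs] sum_mono) (simp add: abs_mult[of "pd_fst _ _ _"] mult_left_mono abs_le_path_quadratic)
    moreover have "\<bar>\<Sum>l\<in>UNIV. pd_snd l G (\<mu> s, A s) * (A u $ l - A s $ l)\<bar> \<le>
        (\<Sum>l\<in>UNIV. \<bar>pd_snd l G (\<mu> s, A s)\<bar> * q)"
      unfolding q_def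
      by (intro order_trans[OF sum_abs] sum_mono) (simp add: abs_mult mult_left_mono abs_le_path_quadratic)
    ultimately show ?thesis
      unfolding second_order_part_def c_def q_def[symmetric]
      by (simp add: sum_distrib_right[symmetric] distrib_right)
  qed
  obtain K where K: "0 \<le> K" "\<And>t. t \<in> {0..T} \<Longrightarrow>
    eventually (\<lambda>n. partition_sum (\<pi> n) (path_quadratic \<mu> A) t \<le> K) sequentially"
    using path_quadratic_bound by blast
  obtain \<delta> where \<delta>: "0 < \<delta>" "\<And>s u. \<lbrakk>0 \<le> s; s \<le> u; u \<le> T; u - s < \<delta>\<rbrakk> \<Longrightarrow>
      \<bar>defect s u + second_order_part s u\<bar> \<le> 1 * path_quadratic \<mu> A s u"
    using defect_expansion[of 1] by auto
  \<comment> \<open>The 1 pays for the remainder, \<open>C\<close> for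
    \<open>second_order_part\<close>. The doubled absolute value matches the form of
    \<open>abs_partition_sum_le_fine\<close>.\<close>
  have d: "\<bar>\<bar>defect s u\<bar>\<bar> \<le> (1 + C) * path_quadratic \<mu> A s u" if "0 \<le> s" "s \<le> u" "u \<le> T" "u - s < \<delta>" for s u
  proof -
    have "c s * path_quadratic \<mu> A s u \<le> C * path_quadratic \<mu> A s u"
      using C[of s] that by (intro mult_right_mono abs_le_path_quadratic) auto
    then show ?thesis using \<delta>(2)[OF that] so[of s u] by (simp add: distrib_right)
  qed
  show ?thesis
  proof (rule that)
    fix t assume t: "t \<in> {0..T}"
    show "eventually (\<lambda>n. partition_sum (\<pi> n) (\<lambda>s u. \<bar>defect s u\<bar>) t \<le> (1 + C) * K) sequentially"
      using refining_partitionsD(3)[OF partitions \<delta>(1)] K(2)[OF t]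
    proof eventually_elim
      case (elim n)
      have "\<bar>partition_sum (\<pi> n) (\<lambda>s u. \<bar>defect s u\<bar>) t\<bar> \<le> (1 + C) * partition_sum (\<pi> n) (path_quadratic \<mu> A) t"
        unfolding partition_sum_cmult[symmetric]
        by (rule abs_partition_sum_le_fine[OF part elim(1) t d])
      also have "\<dots> \<le> (1 + C) * K" using elim(2) C[OF t] by (intro mult_left_mono) auto
      finally show ?case by simp
    qed
  qed
qed

end

section \<open>The Lebesgue--Stieltjes integral\<close>

text \<open>For every nonempty \<open>P\<close> the sum telescopes to
  \<open>g (Min P) - g (Max P)\<close>, which is largest for \<open>P = {a, b}\<close>.\<close>

lemma total_variation_antimono:
  assumes "a \<le> b" and mono: "antimono_on {a..b} g"
  shows "total_variation g a b = g a - (g b :: real)"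
  unfolding total_variation_def
proof (rule cSup_eq_maximum)
  have tele: "(\<Sum>(s, u)\<in>consecutive P. norm (g u - g s)) = g (Min P) - g (Max P)"
    if P: "finite P" "P \<subseteq> {a..b}" "P \<noteq> {}" for P
  proof -
    have "(\<Sum>(s, u)\<in>consecutive P. norm (g u - g s)) = (\<Sum>(s, u)\<in>consecutive P. - g u - - g s)"
    proof (rule sum.cong[OF refl], clarsimp)
      fix s u assume su: "(s, u) \<in> consecutive P"
      have "g u \<le> g s"
        by (rule monotone_onD[OF mono]) (use P su in \<open>auto simp: consecutive_iff\<close>)
      then show "\<bar>g u - g s\<bar> = g s - g u" by simp
    qed
    then show ?thesis using sum_consecutive_telescope[OF P(1,3), of "\<lambda>x. - g x"] by simp
  qed
  show "g a - g b \<in> variation_sums g a b"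
    using tele[of "{a, b}"] \<open>a \<le> b\<close> by (auto simp: variation_sums_def min_def max_def intro!: exI[of _ "{a, b}"])
  fix y assume "y \<in> variation_sums g a b"
  then obtain P where P: "finite P" "P \<subseteq> {a..b}"
    "y = (\<Sum>(s, u)\<in>consecutive P. norm (g u - g s))" by (auto simp: variation_sums_def)
  show "y \<le> g a - g b"
  proof (cases "P = {}")
    case True
    then show ?thesis
      using P(3) monotone_onD[OF mono, of a b] \<open>a \<le> b\<close> by (simp add: consecutive_def)
  next
    case False
    then have "Min P \<in> {a..b}" "Max P \<in> {a..b}" using P Min_in Max_in by blast+
    then have "g (Min P) \<le> g a" "g b \<le> g (Max P)"
      using \<open>a \<le> b\<close> by (auto intro!: monotone_onD[OF mono])
    then show ?thesis using tele[OF P(1,2) False] P(3) by simp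
  qed
qed

text \<open>Additivity over adjacent intervals, and the comparison of \<open>f\<close> with the
  constants \<open>k - e\<close> and \<open>k + e\<close> on an interval of mass
  \<open>H b - H a\<close>.\<close>

lemma interval_measure_Ioc_integral:
  fixes f H :: "real \<Rightarrow> real"
  assumes H: "mono H" "continuous_on UNIV H" and f: "continuous_on UNIV f"
  shows "a \<le> b \<Longrightarrow> b \<le> c \<Longrightarrow> (LINT x:{a<..c}|interval_measure H. f x) =
      (LINT x:{a<..b}|interval_measure H. f x) + (LINT x:{b<..c}|interval_measure H. f x)"
    and "a \<le> b \<Longrightarrow> (\<And>x. x \<in> {a..b} \<Longrightarrow> \<bar>f x - k\<bar> \<le> e) \<Longrightarrow>
      \<bar>(LINT x:{a<..b}|interval_measure H. f x) - k * (H b - H a)\<bar> \<le> e * (H b - H a)"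
proof -
  have cont: "continuous (at_right x) H" for x
    using H(2) by (auto simp: continuous_on_eq_continuous_at intro: continuous_at_imp_continuous_at_within)
  have emeasure: "emeasure (interval_measure H) {a<..b} = ennreal (H b - H a)" if "a \<le> b" for a b
    using emeasure_interval_measure_Ioc[OF that monoD[OF H(1)] cont] by simp
  have measure: "measure (interval_measure H) {a<..b} = H b - H a" if "a \<le> b" for a b
    using measure_interval_measure_Ioc[OF that monoD[OF H(1)] cont] by simp
  have integrable: "set_integrable (interval_measure H) {a<..b} h"
    if "continuous_on UNIV h" "a \<le> b" for a b and h :: "real \<Rightarrow> real"
  proof -
    have "compact (h ` {a..b})" by (intro compact_continuous_image continuous_on_subset[OF that(1)]) auto
    then obtain B where "\<forall>x\<in>{a..b}. \<bar>h x\<bar> \<le> B"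
      by (auto dest!: compact_imp_bounded simp only: bounded_iff real_norm_def ball_simps)
    moreover have "h \<in> borel_measurable (interval_measure H)"
      using borel_measurable_continuous_onI[OF that(1)]
      by (simp add: measurable_cong_sets[OF sets_interval_measure refl])
    ultimately show ?thesis
      unfolding set_integrable_def using emeasure[OF that(2)]
      by (intro integrableI_bounded_set_indicator[where B = B]) auto
  qed
  show "(LINT x:{a<..c}|interval_measure H. f x) =
      (LINT x:{a<..b}|interval_measure H. f x) + (LINT x:{b<..c}|interval_measure H. f x)"
    if "a \<le> b" "b \<le> c"
  proof -
    have "{a<..c} = {a<..b} \<union> {b<..c}" using that by auto
    then show ?thesis using that by (simp add: set_integral_Un integrable f)
  qed
  show "\<bar>(LINT x:{a<..b}|interval_measure H. f x) - k * (H b - H a)\<bar> \<le> e * (H b - H a)"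
    if ab: "a \<le> b" and k: "\<And>x. x \<in> {a..b} \<Longrightarrow> \<bar>f x - k\<bar> \<le> e"
  proof -
    have const: "(LINT x:{a<..b}|interval_measure H. r) = r * (H b - H a)" for r :: real
      using emeasure[OF ab] by (simp add: set_integral_const measure[OF ab])
    have bounds: "k - e \<le> f x \<and> f x \<le> k + e" if "x \<in> {a<..b}" for x
      using k[of x] that by (simp add: abs_le_iff)
    have "(LINT x:{a<..b}|interval_measure H. k - e) \<le> (LINT x:{a<..b}|interval_measure H. f x)"
      using bounds by (intro set_integral_mono integrable f ab continuous_on_const) auto
    moreover have "(LINT x:{a<..b}|interval_measure H. f x) \<le> (LINT x:{a<..b}|interval_measure H. k + e)"
      using bounds by (intro set_integral_mono integrable f ab continuous_on_const) auto
    ultimately show ?thesis unfolding const by (simp add: abs_le_iff algebra_simps)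
  qed
qed

text \<open>Describes \<Phi> as an indefinite integral of \<open>f\<close> against a nonincreasing
  \<Gamma>, free of measures; \<open>\<Gamma> s - \<Gamma> u\<close> is the variation of \<Gamma> on
  the interval. The later estimates reach \<open>LS_integral\<close> through this property and its
  value 0 at 0.\<close>

definition stieltjes_estimate :: "(real \<Rightarrow> real) \<Rightarrow> (real \<Rightarrow> real) \<Rightarrow> real \<Rightarrow> (real \<Rightarrow> real) \<Rightarrow> bool" where
  "stieltjes_estimate f \<Gamma> T \<Phi> \<longleftrightarrow> (\<forall>s u k e. 0 \<le> s \<longrightarrow> s \<le> u \<longrightarrow> u \<le> T \<longrightarrow>
     (\<forall>x\<in>{s..u}. \<bar>f x - k\<bar> \<le> e) \<longrightarrow> \<bar>\<Phi> u - \<Phi> s - k * (\<Gamma> u - \<Gamma> s)\<bar> \<le> e * (\<Gamma> s - \<Gamma> u))"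

lemma stieltjes_estimateD:
  assumes "stieltjes_estimate f \<Gamma> T \<Phi>" "0 \<le> s" "s \<le> u" "u \<le> T"
    "\<And>x. x \<in> {s..u} \<Longrightarrow> \<bar>f x - k\<bar> \<le> e"
  shows "\<bar>\<Phi> u - \<Phi> s - k * (\<Gamma> u - \<Gamma> s)\<bar> \<le> e * (\<Gamma> s - \<Gamma> u)"
  using assms unfolding stieltjes_estimate_def by blast

text \<open>On a short cell both increments are close to the same Riemann-Stieltjes term, so they
  differ by at most \<open>2 * e\<close> times the drop of \<Gamma>. The drops telescope, and
  \<open>e\<close> tends to 0.\<close>

lemma stieltjes_estimate_unique:
  assumes \<pi>: "refining_partitions T \<pi>" and f: "continuous_on {0..T} f" and v: "v \<in> {0..T}"
    and \<Phi>: "stieltjes_estimate f \<Gamma> v \<Phi>" and \<Psi>: "stieltjes_estimate f \<Gamma> v \<Psi>"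
  shows "\<Phi> v - \<Phi> 0 = \<Psi> v - \<Psi> 0"
proof -
  note part = refining_partitionsD(1)[OF \<pi>]
  have *: "\<bar>(\<Phi> v - \<Phi> 0) - (\<Psi> v - \<Psi> 0)\<bar> \<le> 2 * e * (\<Gamma> 0 - \<Gamma> v)" if e: "0 < e" for e
  proof -
    obtain \<delta> where \<delta>: "0 < \<delta>"
      "\<And>x y. x \<in> {0..T} \<Longrightarrow> y \<in> {0..T} \<Longrightarrow> \<bar>x - y\<bar> < \<delta> \<Longrightarrow> \<bar>f x - f y\<bar> \<le> e"
      using uniformly_continuous_real[OF f e] by blast
    obtain n where n: "finer_than \<delta> (\<pi> n)"
      using eventually_happens'[OF sequentially_bot refining_partitionsD(3)[OF \<pi> \<delta>(1)]] by blast
    have "\<bar>partition_sum (\<pi> n) (\<lambda>s u. (\<Phi> u - \<Psi> u) - (\<Phi> s - \<Psi> s)) v\<bar> \<le>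
      partition_sum (\<pi> n) (\<lambda>s u. - (2 * e) * \<Gamma> u - - (2 * e) * \<Gamma> s) v"
    proof (rule abs_partition_sum_le)
      fix s u assume su: "(s, u) \<in> consecutive (\<pi> n)"
      define s' u' where "s' = min s v" and "u' = min u v"
      have "u - s < \<delta>" using n su by (auto simp: finer_than_def)
      then have su': "0 \<le> s'" "s' \<le> u'" "u' \<le> v" "u' - s' < \<delta>"
        using consecutiveD[OF su] partition_ofD(4)[OF part] v by (auto simp: s'_def u'_def min_def)
      then have "\<bar>f x - f s'\<bar> \<le> e" if "x \<in> {s'..u'}" for x
        using that v by (intro \<delta>(2)) auto
      with \<Phi> \<Psi> su'(1-3) have "\<bar>\<Phi> u' - \<Phi> s' - f s' * (\<Gamma> u' - \<Gamma> s')\<bar> \<le> e * (\<Gamma> s' - \<Gamma> u')"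
        "\<bar>\<Psi> u' - \<Psi> s' - f s' * (\<Gamma> u' - \<Gamma> s')\<bar> \<le> e * (\<Gamma> s' - \<Gamma> u')"
        by (auto intro!: stieltjes_estimateD)
      then show "\<bar>\<Phi> (min u v) - \<Psi> (min u v) - (\<Phi> (min s v) - \<Psi> (min s v))\<bar>
          \<le> - (2 * e) * \<Gamma> (min u v) - - (2 * e) * \<Gamma> (min s v)"
        unfolding s'_def[symmetric] u'_def[symmetric] by (simp add: algebra_simps)
    qed
    then show ?thesis
      using partition_sum_telescope[OF part v, of n "\<lambda>t. \<Phi> t - \<Psi> t"]
        partition_sum_telescope[OF part v, of n "\<lambda>t. - (2 * e) * \<Gamma> t"]
      by (simp add: algebra_simps)
  qed
  have "((\<lambda>e. 2 * e * (\<Gamma> 0 - \<Gamma> v)) \<longlongrightarrow> 2 * 0 * (\<Gamma> 0 - \<Gamma> v)) (at_right 0)"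
    by (intro tendsto_intros)
  moreover have "eventually (\<lambda>e. \<bar>(\<Phi> v - \<Phi> 0) - (\<Psi> v - \<Psi> 0)\<bar> \<le> 2 * e * (\<Gamma> 0 - \<Gamma> v)) (at_right 0)"
    using * by (auto simp: eventually_at_right_field intro: exI[of _ 1])
  ultimately have "\<bar>(\<Phi> v - \<Phi> 0) - (\<Psi> v - \<Psi> 0)\<bar> \<le> 2 * 0 * (\<Gamma> 0 - \<Gamma> v)"
    by (rule tendsto_lowerbound) simp
  then show ?thesis by simp
qed

text \<open>For nonincreasing \<Gamma> the positive variation is zero and the negative one is
  \<open>\<Gamma> 0 - \<Gamma>\<close>, so only minus the second integral remains. Its measure
  depends on the upper limit \<open>t\<close>; \<open>stieltjes_estimate_unique\<close> removes this
  dependence.\<close>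

lemma LS_integral_estimate:
  assumes \<pi>: "refining_partitions T \<pi>" and f: "continuous_on {0..T} f"
    and \<Gamma>: "continuous_on {0..T} \<Gamma>" "antimono_on {0..T} \<Gamma>"
  shows "stieltjes_estimate f \<Gamma> T (LS_integral f \<Gamma> 0)" and "LS_integral f \<Gamma> 0 0 = 0"
proof -
  have T: "0 \<le> T" using partition_ofD(6)[OF refining_partitionsD(1)[OF \<pi>]] .
  define clamp where "clamp t r = max 0 (min t r)" for t r :: real
  define H where "H t r = \<Gamma> 0 - \<Gamma> (clamp t r)" for t r
  \<comment> \<open>A continuous extension of \<open>f\<close> to the whole line, as the facts on
    \<open>interval_measure\<close> require.\<close>
  define f' where "f' r = f (clamp T r)" for r
  \<comment> \<open>\<open>t\<close> is the horizon at which the measure is cut off,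
    \<open>v\<close> the upper limit of integration; the sign is that of the negative
    variation.\<close>
  define I where "I t v = - (LINT x:{0<..v}|interval_measure (H t). f' x)" for t v
  have clamp: "clamp t r \<in> {0..T}" "r \<in> {0..t} \<Longrightarrow> clamp t r = r" if "t \<in> {0..T}" for t r
    using that by (auto simp: clamp_def)
  have clamp_cont: "continuous_on UNIV (clamp t)" for t
    unfolding clamp_def by (intro continuous_intros)
  have H: "mono (H t)" "continuous_on UNIV (H t)" if "t \<in> {0..T}" for t
  proof -
    show "mono (H t)"
    proof (rule monoI)
      fix x y :: real assume "x \<le> y"
      then have "clamp t x \<le> clamp t y" by (auto simp: clamp_def)
      then show "H t x \<le> H t y"
        unfolding H_def using clamp(1)[OF that] by (auto intro: monotone_onD[OF \<Gamma>(2)])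
    qed
    show "continuous_on UNIV (H t)"
      unfolding H_def using clamp(1)[OF that]
      by (intro continuous_intros continuous_on_compose2[OF \<Gamma>(1) clamp_cont]) auto
  qed
  have f': "continuous_on UNIV f'"
    unfolding f'_def using clamp(1) T by (intro continuous_on_compose2[OF f clamp_cont]) auto
  have est: "stieltjes_estimate f \<Gamma> t (I t)" if t: "t \<in> {0..T}" for t
    unfolding stieltjes_estimate_def
  proof (intro allI impI)
    fix s u k e assume su: "0 \<le> s" "s \<le> u" "u \<le> t" and k: "\<forall>x\<in>{s..u}. \<bar>f x - k\<bar> \<le> e"
    have "\<bar>f' x - k\<bar> \<le> e" if "x \<in> {s..u}" for x
      using k that su t by (simp add: f'_def clamp_def)
    from interval_measure_Ioc_integral(2)[OF H[OF t] f' su(2) this]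
    have "\<bar>(LINT x:{s<..u}|interval_measure (H t). f' x) - k * (H t u - H t s)\<bar> \<le> e * (H t u - H t s)" .
    moreover have "H t u - H t s = \<Gamma> s - \<Gamma> u"
      using su by (simp add: H_def clamp(2)[OF t])
    moreover have "I t u - I t s = - (LINT x:{s<..u}|interval_measure (H t). f' x)"
      unfolding I_def using interval_measure_Ioc_integral(1)[OF H[OF t] f' su(1,2)] by simp
    ultimately show "\<bar>I t u - I t s - k * (\<Gamma> u - \<Gamma> s)\<bar> \<le> e * (\<Gamma> s - \<Gamma> u)"
      by (simp add: abs_le_iff algebra_simps)
  qed
  have LS: "LS_integral f \<Gamma> 0 t = I t t" if t: "t \<in> {0..T}" for t
  proof -
    have tv: "total_variation \<Gamma> 0 (clamp t r) = \<Gamma> 0 - \<Gamma> (clamp t r)" for r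
      using clamp(1)[OF t, of r] by (intro total_variation_antimono monotone_on_subset[OF \<Gamma>(2)]) auto
    have "emeasure (interval_measure (\<lambda>r. 0)) {0<..t} = 0"
      using t by (subst emeasure_interval_measure_Ioc) auto
    then have "AE x in interval_measure (\<lambda>r. 0). x \<notin> {0<..t}"
      by (intro AE_not_in null_setsI) auto
    then have "(LINT s:{0<..t}|interval_measure (\<lambda>r. 0). f s) = 0"
      unfolding set_lebesgue_integral_def by (intro integral_eq_zero_AE) (auto elim: eventually_mono)
    moreover have "(\<lambda>r. positive_variation \<Gamma> 0 (max 0 (min t r))) = (\<lambda>r. 0)"
      unfolding clamp_def[symmetric] by (simp add: positive_variation_def tv)
    moreover have "(\<lambda>r. negative_variation \<Gamma> 0 (max 0 (min t r))) = H t"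
      unfolding clamp_def[symmetric] by (simp add: negative_variation_def tv H_def fun_eq_iff)
    moreover have "(LINT s:{0<..t}|interval_measure (H t). f s) = (LINT s:{0<..t}|interval_measure (H t). f' s)"
      using t by (intro set_lebesgue_integral_cong) (auto simp: f'_def clamp_def)
    ultimately show ?thesis by (simp add: LS_integral_def I_def)
  qed
  have I0: "I t 0 = 0" for t by (simp add: I_def set_lebesgue_integral_def)
  \<comment> \<open>The two integrals use different measures, but both satisfy the estimate on
    \<open>[0, t]\<close>.\<close>
  have "I t t = I T t" if t: "t \<in> {0..T}" for t
  proof -
    have "stieltjes_estimate f \<Gamma> t (I T)"
      using est[of T] T t unfolding stieltjes_estimate_def by auto
    from stieltjes_estimate_unique[OF \<pi> f t est[OF t] this] show ?thesis by (simp add: I0)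
  qed
  then have LS': "LS_integral f \<Gamma> 0 t = I T t" if "t \<in> {0..T}" for t using LS that by simp
  then show "LS_integral f \<Gamma> 0 0 = 0" using T I0 by simp
  show "stieltjes_estimate f \<Gamma> T (LS_integral f \<Gamma> 0)"
    using est[of T] T unfolding stieltjes_estimate_def by (simp add: LS')
qed

section \<open>Multiplicative generation\<close>

text \<open>Both sides come from \<open>1 + z \<le> exp z\<close>, taken at \<open>z = y - x\<close>
  and at \<open>z = x - y\<close>.\<close>

lemma exp_increment_bounds:
  fixes x y :: real
  assumes "y \<le> x"
  shows "\<bar>exp y - exp x - exp x * (y - x)\<bar> \<le> (x - y) * (exp x - exp y)"
proof -
  have "exp x * (1 + (y - x)) \<le> exp x * exp (y - x)"
    by (intro mult_left_mono exp_ge_add_one_self) auto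
  moreover have "exp y * (1 + (x - y)) \<le> exp y * exp (x - y)"
    by (intro mult_left_mono exp_ge_add_one_self) auto
  ultimately show ?thesis by (simp add: exp_diff abs_le_iff algebra_simps)
qed

section \<open>The exponential factor and its product rule with the generating function\<close>

context regular_path
begin

context
  assumes G_pos: "\<And>z. 0 < G z"
    and Gam_antimono: "antimono_on {0..T} (Gam \<pi> G \<mu> A)"
begin

abbreviation \<Gamma> :: "real \<Rightarrow> real" where "\<Gamma> \<equiv> Gam \<pi> G \<mu> A"

definition log_factor :: "real \<Rightarrow> real" where
  "log_factor = LS_integral (\<lambda>s. 1 / g s) \<Gamma> 0"

lemma inverse_g_cont: "continuous_on {0..T} (\<lambda>s. 1 / g s)"
  using G_pos by (intro continuous_intros g_cont) (auto simp: less_imp_neq[symmetric])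

lemma log_factor_estimate: "stieltjes_estimate (\<lambda>s. 1 / g s) \<Gamma> T log_factor"
  and log_factor_0: "log_factor 0 = 0"
  unfolding log_factor_def
  using LS_integral_estimate[OF partitions inverse_g_cont Gam_limit(1) Gam_antimono] by auto

text \<open>As \<open>1 / g\<close> lies between 0 and \<open>B\<close>, the estimate applies with
  centre and radius both \<open>B / 2\<close>; its two sides are the two claims.\<close>

lemma log_factor_bounds:
  assumes B: "\<And>x. x \<in> {0..T} \<Longrightarrow> 1 / g x \<le> B" and su: "0 \<le> s" "s \<le> u" "u \<le> T"
  shows "B * (\<Gamma> u - \<Gamma> s) \<le> log_factor u - log_factor s" "log_factor u \<le> log_factor s"
proof -
  have "\<bar>1 / g x - B / 2\<bar> \<le> B / 2" if "x \<in> {s..u}" for x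
  proof -
    have "0 < 1 / g x" using G_pos by simp
    moreover have "1 / g x \<le> B" using that su by (intro B) auto
    ultimately show ?thesis by (simp only: abs_le_iff) linarith
  qed
  from stieltjes_estimateD[OF log_factor_estimate su this]
  have *: "\<bar>log_factor u - log_factor s - B / 2 * (\<Gamma> u - \<Gamma> s)\<bar> \<le> B / 2 * (\<Gamma> s - \<Gamma> u)" .
  show "log_factor u \<le> log_factor s" "B * (\<Gamma> u - \<Gamma> s) \<le> log_factor u - log_factor s"
    using * unfolding abs_le_iff by (simp_all add: algebra_simps)
qed

lemma inverse_g_bounded:
  obtains B where "0 < B" "\<And>x. x \<in> {0..T} \<Longrightarrow> 1 / g x \<le> B"
proof (rule continuous_bounded_real[OF inverse_g_cont])
  fix C assume C: "\<And>t. t \<in> {0..T} \<Longrightarrow> \<bar>1 / g t\<bar> \<le> C"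
  show ?thesis
  proof (rule that[of "\<bar>C\<bar> + 1"])
    show "1 / g x \<le> \<bar>C\<bar> + 1" if "x \<in> {0..T}" for x using C[OF that] by linarith
  qed simp
qed

text \<open>Increments of \<open>log_factor\<close> are at most \<open>B\<close> times those of
  \<Gamma>, which is continuous.\<close>

lemma log_factor_cont: "continuous_on {0..T} log_factor"
proof (rule inverse_g_bounded)
  fix B assume B: "0 < B" "\<And>x. x \<in> {0..T} \<Longrightarrow> 1 / g x \<le> B"
  have le: "\<bar>log_factor y - log_factor x\<bar> \<le> B * \<bar>\<Gamma> y - \<Gamma> x\<bar>" if "x \<in> {0..T}" "y \<in> {0..T}" for x y
  proof -
    have *: "\<bar>log_factor y - log_factor x\<bar> \<le> B * \<bar>\<Gamma> y - \<Gamma> x\<bar>" if "0 \<le> x" "x \<le> y" "y \<le> T" for x y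
    proof -
      have "\<Gamma> y \<le> \<Gamma> x" by (rule monotone_onD[OF Gam_antimono]) (use that in auto)
      then show ?thesis using log_factor_bounds[OF B(2) that] by (simp add: algebra_simps)
    qed
    show ?thesis using *[of x y] *[of y x] that by (cases "x \<le> y") (auto simp: abs_minus_commute)
  qed
  show ?thesis
    unfolding continuous_on_def
  proof
    fix x assume x: "x \<in> {0..T}"
    have \<Gamma>: "(\<Gamma> \<longlongrightarrow> \<Gamma> x) (at x within {0..T})" using Gam_limit(1) x by (auto simp: continuous_on_def)
    have "((\<lambda>y. B * \<bar>\<Gamma> y - \<Gamma> x\<bar>) \<longlongrightarrow> B * \<bar>\<Gamma> x - \<Gamma> x\<bar>) (at x within {0..T})"
      by (intro tendsto_intros \<Gamma>)
    then have "((\<lambda>y. B * \<bar>\<Gamma> y - \<Gamma> x\<bar>) \<longlongrightarrow> 0) (at x within {0..T})" by simp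
    moreover have "eventually (\<lambda>y. norm (log_factor y - log_factor x) \<le> B * \<bar>\<Gamma> y - \<Gamma> x\<bar>) (at x within {0..T})"
      unfolding eventually_at_filter using le[OF x] by (auto intro: always_eventually)
    ultimately have "((\<lambda>y. log_factor y - log_factor x) \<longlongrightarrow> 0) (at x within {0..T})"
      by (rule Lim_null_comparison[rotated])
    then show "(log_factor \<longlongrightarrow> log_factor x) (at x within {0..T})" by (rule LIM_zero_cancel)
  qed
qed

abbreviation E :: "real \<Rightarrow> real" where "E t \<equiv> exp (log_factor t)"

text \<open>Discrete form of \<open>G dE = E d\<Gamma>\<close>. The error is measured by the drop of
  \<Gamma>, so its sum over a partition is at most \<open>e\<close> times the total drop.\<close>

lemma product_rule_error:
  assumes "0 < e"
  obtains \<delta> where "0 < \<delta>"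
    "\<And>s u. \<lbrakk>0 \<le> s; s \<le> u; u \<le> T; u - s < \<delta>\<rbrakk> \<Longrightarrow>
      \<bar>g u * (E u - E s) - E s * (\<Gamma> u - \<Gamma> s)\<bar> \<le> e * (\<Gamma> s - \<Gamma> u)"
proof -
  obtain B where B: "0 < B" "\<And>x. x \<in> {0..T} \<Longrightarrow> 1 / g x \<le> B" using inverse_g_bounded by blast
  obtain C where C: "\<And>x. x \<in> {0..T} \<Longrightarrow> \<bar>g x\<bar> \<le> C" using continuous_bounded_real[OF g_cont] by blast
  have "0 < C" using C[of 0] G_pos[of "(\<mu> 0, A 0)"] T_pos by auto
  \<comment> \<open>Linearizing \<open>exp\<close> costs \<open>C * B * e'\<close> and freezing
    \<open>1 / g\<close> costs \<open>C * e'\<close>, each per unit drop of \<Gamma>; together they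
    give \<open>e\<close>.\<close>
  define e' where "e' = e / (C * (B + 1))"
  have e': "0 < e'" using assms B(1) \<open>0 < C\<close> by (simp add: e'_def)
  have "C * (B * e' + e') = (C * (B + 1)) * e'" by (simp add: algebra_simps)
  also have "\<dots> = e" using B(1) \<open>0 < C\<close> by (simp add: e'_def)
  finally have Ce': "C * (B * e' + e') = e" .
  obtain \<delta>1 where \<delta>1: "0 < \<delta>1"
    "\<And>x y. x \<in> {0..T} \<Longrightarrow> y \<in> {0..T} \<Longrightarrow> \<bar>x - y\<bar> < \<delta>1 \<Longrightarrow> \<bar>1 / g x - 1 / g y\<bar> \<le> e'"
    using uniformly_continuous_real[OF inverse_g_cont e'] by blast
  have "continuous_on {0..T} E" by (intro continuous_intros log_factor_cont)
  from uniformly_continuous_real[OF this e'] obtain \<delta>2 where \<delta>2: "0 < \<delta>2"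
    "\<And>x y. x \<in> {0..T} \<Longrightarrow> y \<in> {0..T} \<Longrightarrow> \<bar>x - y\<bar> < \<delta>2 \<Longrightarrow> \<bar>E x - E y\<bar> \<le> e'" by blast
  show ?thesis
  proof (rule that[of "min \<delta>1 \<delta>2"])
    fix s u assume su: "0 \<le> s" "s \<le> u" "u \<le> T" "u - s < min \<delta>1 \<delta>2"
    define x where "x = log_factor u - log_factor s"
    define d where "d = \<Gamma> s - \<Gamma> u"
    have x: "x \<le> 0" "- x \<le> B * d"
      using log_factor_bounds[OF B(2) su(1-3)] by (auto simp: x_def d_def algebra_simps)
    have d: "0 \<le> d"
      unfolding d_def using monotone_onD[OF Gam_antimono, of s u] su by auto
    have gu: "0 < g u" "g u \<le> C" using G_pos C[of u] su by auto
    have "E s \<le> 1" using log_factor_bounds(2)[OF B(2), of 0 s] su log_factor_0 by auto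
    \<comment> \<open>Frozen at the right endpoint, so that it cancels against the factor
      \<open>g u\<close>.\<close>
    have "\<bar>1 / g r - 1 / g u\<bar> \<le> e'" if "r \<in> {s..u}" for r
      using that su by (intro \<delta>1(2)) auto
    from stieltjes_estimateD[OF log_factor_estimate su(1-3) this]
    have est: "\<bar>x - 1 / g u * (\<Gamma> u - \<Gamma> s)\<bar> \<le> e' * d" by (simp add: x_def d_def)
    have "g u * x - (\<Gamma> u - \<Gamma> s) = g u * (x - 1 / g u * (\<Gamma> u - \<Gamma> s))"
      using gu(1) by (simp add: right_diff_distrib)
    then have "\<bar>g u * x - (\<Gamma> u - \<Gamma> s)\<bar> = g u * \<bar>x - 1 / g u * (\<Gamma> u - \<Gamma> s)\<bar>"
      using gu(1) by (simp add: abs_mult)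
    also have "\<dots> \<le> C * (e' * d)" using est gu by (intro mult_mono) auto
    finally have 1: "\<bar>g u * x - (\<Gamma> u - \<Gamma> s)\<bar> \<le> C * (e' * d)" .
    have "\<bar>E u - E s - E s * x\<bar> \<le> (- x) * (E s - E u)"
      using exp_increment_bounds[of "log_factor u" "log_factor s"] x(1) by (simp add: x_def)
    \<comment> \<open>One factor is controlled by the drop of \<Gamma>, the other is small by
      uniform continuity of \<open>E\<close>.\<close>
    also have "\<dots> \<le> (B * d) * e'"
      using x x(1)[unfolded x_def] \<delta>2(2)[of s u] su B(1) d by (intro mult_mono) auto
    finally have "\<bar>E u - E s - E s * x\<bar> \<le> B * d * e'" .
    then have 2: "\<bar>g u * (E u - E s - E s * x)\<bar> \<le> C * (B * d * e')"
      unfolding abs_mult using gu by (intro mult_mono) auto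
    have 3: "\<bar>E s * (g u * x - (\<Gamma> u - \<Gamma> s))\<bar> \<le> 1 * (C * (e' * d))"
      unfolding abs_mult using \<open>E s \<le> 1\<close> 1 by (intro mult_mono) auto
    have "g u * (E u - E s) - E s * (\<Gamma> u - \<Gamma> s) =
        g u * (E u - E s - E s * x) + E s * (g u * x - (\<Gamma> u - \<Gamma> s))"
      by (simp add: algebra_simps)
    then have "\<bar>g u * (E u - E s) - E s * (\<Gamma> u - \<Gamma> s)\<bar> \<le> C * (B * d * e') + 1 * (C * (e' * d))"
      using 2 3 abs_triangle_ineq[of "g u * (E u - E s - E s * x)" "E s * (g u * x - (\<Gamma> u - \<Gamma> s))"]
      by linarith
    also have "\<dots> = C * (B * e' + e') * d" by (simp add: algebra_simps)
    finally show "\<bar>g u * (E u - E s) - E s * (\<Gamma> u - \<Gamma> s)\<bar> \<le> e * (\<Gamma> s - \<Gamma> u)"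
      by (simp add: Ce' d_def)
  qed (use \<delta>1 \<delta>2 in auto)
qed

text \<open>The Riemann sums split into weighted sums of \<open>defect\<close>, sums of
  \<open>E d\<Gamma>\<close>, a telescoping part and the error \<open>R\<close>. The first two have
  the same limit \<open>J\<close> by \<open>weighted_partition_sum_limit\<close> and cancel.\<close>

lemma pathwise_integral_mult_eta:
  assumes t: "t \<in> {0..T}"
  shows "pathwise_integral \<pi> (mult_eta \<pi> G \<mu> A) \<mu> t = g t * E t - g 0"
proof -
  have E_cont: "continuous_on {0..T} E" by (intro continuous_intros log_factor_cont)
  obtain K where K: "\<And>t. t \<in> {0..T} \<Longrightarrow>
    eventually (\<lambda>n. partition_sum (\<pi> n) (\<lambda>s u. \<bar>defect s u\<bar>) t \<le> K) sequentially"
    using defect_bound by blast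
  obtain J where J:
    "\<And>t. t \<in> {0..T} \<Longrightarrow> (\<lambda>n. partition_sum (\<pi> n) (\<lambda>s u. E s * defect s u) t) \<longlonglongrightarrow> J t"
    "uniform_limit {0..T} (\<lambda>m. partition_sum (\<pi> m) (\<lambda>s u. E s * (\<Gamma> u - \<Gamma> s))) J sequentially"
    by (rule weighted_partition_sum_limit[OF partitions defect_self Gam_limit(2) K E_cont])
      (assumption | rule that)+
  have J': "(\<lambda>m. partition_sum (\<pi> m) (\<lambda>s u. E s * (\<Gamma> u - \<Gamma> s)) t) \<longlonglongrightarrow> J t"
    using J(2) t by (rule tendsto_uniform_limitI)
  define R where "R s u = g u * (E u - E s) - E s * (\<Gamma> u - \<Gamma> s)" for s u
  have R: "(\<lambda>n. partition_sum (\<pi> n) R t) \<longlonglongrightarrow> 0"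
  proof (rule tendstoI)
    fix e :: real assume "0 < e"
    define c where "c = \<Gamma> 0 - \<Gamma> t"
    have c: "0 \<le> c" unfolding c_def using monotone_onD[OF Gam_antimono, of 0 t] t by auto
    define e' where "e' = e / (c + 1)"
    have e': "0 < e'" using \<open>0 < e\<close> c by (simp add: e'_def)
    have "e' * c < e" using \<open>0 < e\<close> c by (simp add: e'_def divide_simps)
    obtain \<delta> where \<delta>: "0 < \<delta>" "\<And>s u. \<lbrakk>0 \<le> s; s \<le> u; u \<le> T; u - s < \<delta>\<rbrakk> \<Longrightarrow>
      \<bar>R s u\<bar> \<le> e' * (\<Gamma> s - \<Gamma> u)"
      using product_rule_error[OF e'] unfolding R_def by blast
    show "eventually (\<lambda>n. dist (partition_sum (\<pi> n) R t) 0 < e) sequentially"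
      using refining_partitionsD(3)[OF partitions \<delta>(1)]
    proof eventually_elim
      case (elim n)
      have "\<bar>partition_sum (\<pi> n) R t\<bar> \<le> e' * partition_sum (\<pi> n) (\<lambda>s u. - \<Gamma> u - - \<Gamma> s) t"
        unfolding partition_sum_cmult[symmetric]
        by (rule abs_partition_sum_le_fine[OF part elim t]) (use \<delta>(2) in simp)
      also have "\<dots> = e' * c"
        using partition_sum_telescope[OF part t, of n "\<lambda>r. - \<Gamma> r"] by (simp add: c_def)
      finally show ?case using \<open>e' * c < e\<close> by simp
    qed
  qed
  define P where "P = (\<lambda>s u. \<Sum>i\<in>UNIV. mult_eta \<pi> G \<mu> A s $ i * (\<mu> u $ i - \<mu> s $ i))"
  \<comment> \<open>Summation by parts: \<open>E s * (g u - g s)\<close> is the increment of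
    \<open>g * E\<close> minus \<open>g u * (E u - E s)\<close>, and the last product is
    \<open>E s * (\<Gamma> u - \<Gamma> s) + R s u\<close>.\<close>
  have "P = (\<lambda>s u. (E s * defect s u - E s * (\<Gamma> u - \<Gamma> s)) + ((g u * E u - g s * E s) - R s u))"
  proof (intro ext)
    fix s u
    have "P s u = E s * (\<Sum>i\<in>UNIV. pd_fst i G (\<mu> s, A s) * (\<mu> u $ i - \<mu> s $ i))"
      by (simp add: P_def mult_eta_def log_factor_def sum_distrib_left algebra_simps)
    then show "P s u = (E s * defect s u - E s * (\<Gamma> u - \<Gamma> s)) + ((g u * E u - g s * E s) - R s u)"
      by (simp add: defect_def R_def algebra_simps)
  qed
  then have "partition_sum (\<pi> n) P t = (partition_sum (\<pi> n) (\<lambda>s u. E s * defect s u) t -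
      partition_sum (\<pi> n) (\<lambda>s u. E s * (\<Gamma> u - \<Gamma> s)) t) +
      ((g t * E t - g 0 * E 0) - partition_sum (\<pi> n) R t)" for n
    by (simp only: partition_sum_add partition_sum_diff[of _ "\<lambda>s u. E s * defect s u"]
        partition_sum_diff[of _ "\<lambda>s u. g u * E u - g s * E s"]
        partition_sum_telescope[OF part t, of n "\<lambda>r. g r * E r"])
  moreover have "(\<lambda>n. (partition_sum (\<pi> n) (\<lambda>s u. E s * defect s u) t -
      partition_sum (\<pi> n) (\<lambda>s u. E s * (\<Gamma> u - \<Gamma> s)) t) +
      ((g t * E t - g 0 * E 0) - partition_sum (\<pi> n) R t))
      \<longlonglongrightarrow> (J t - J t) + ((g t * E t - g 0 * E 0) - 0)"
    by (intro tendsto_intros J(1) t J' R)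
  ultimately show ?thesis
    unfolding pathwise_integral_alt P_def[symmetric] by (intro limI) (simp add: log_factor_0)
qed

text \<open>The weights sum to 1, so subtracting \<open>c\<close> from every coordinate lowers the
  value by \<open>c\<close>. As \<open>E 0 = 1\<close>, the initial values in the two defects
  cancel, and what is left is the integral of \<open>mult_eta\<close> plus
  \<open>g 0\<close>.\<close>

lemma portfolio_value_mult_generated:
  assumes sum_1: "\<And>r. r \<in> {0..T} \<Longrightarrow> (\<Sum>i\<in>UNIV. \<mu> r $ i) = 1" and t: "t \<in> {0..T}"
  shows "portfolio_value (mult_generated \<pi> G \<mu> A) \<mu> t = g t * E t"
proof -
  have eta_0: "mult_eta \<pi> G \<mu> A 0 $ i = pd_fst i G (\<mu> 0, A 0)" for i
    using log_factor_0 by (simp add: mult_eta_def log_factor_def)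
  define c where "c = self_financing_defect \<pi> (mult_eta \<pi> G \<mu> A) \<mu> t + initial_defect G \<mu> A"
  have "portfolio_value (mult_generated \<pi> G \<mu> A) \<mu> t =
      (\<Sum>i\<in>UNIV. mult_eta \<pi> G \<mu> A t $ i * \<mu> t $ i) - c * (\<Sum>i\<in>UNIV. \<mu> t $ i)"
    by (simp add: portfolio_value_def mult_generated_def c_def left_diff_distrib distrib_right sum_subtractf sum_distrib_left[symmetric])
  also have "\<dots> = portfolio_value (mult_eta \<pi> G \<mu> A) \<mu> t - c"
    by (simp add: sum_1[OF t] portfolio_value_def)
  also have "\<dots> = g t * E t"
    unfolding c_def self_financing_defect_def pathwise_integral_mult_eta[OF t] initial_defect_def
    by (simp add: portfolio_value_def eta_0)
  finally show ?thesis .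
qed

end

end

section \<open>Market weights and the arbitrage estimate\<close>

lemma market_weights_path:
  assumes "market_prices T S"
  shows "continuous_on {0..T} (market_weights S)"
    and "t \<in> {0..T} \<Longrightarrow> (\<Sum>i\<in>UNIV. market_weights S t $ i) = 1"
proof -
  have pos: "(\<Sum>k\<in>UNIV. S t $ k) \<noteq> 0" if "t \<in> {0..T}" for t
    using assms that by (force simp: market_prices_def)
  show "continuous_on {0..T} (market_weights S)"
    unfolding market_weights_def using assms pos
    by (intro continuous_intros) (auto simp: market_prices_def)
  show "t \<in> {0..T} \<Longrightarrow> (\<Sum>i\<in>UNIV. market_weights S t $ i) = 1"
    using pos by (simp add: market_weights_def sum_divide_distrib[symmetric])
qed

theorem theorem4p9:
  fixes T T_star \<kappa> :: real
    and \<pi> :: "nat \<Rightarrow> real set"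
    and S \<mu> :: "real \<Rightarrow> real^'d"
    and A :: "real \<Rightarrow> real^'m"
    and G F :: "(real^'d) \<times> (real^'m) \<Rightarrow> real"
  assumes T_pos: "0 < T"
    and dim: "2 \<le> CARD('d)"
    and partitions: "refining_partitions T \<pi>"
    and prices: "market_prices T S"
    and weights: "\<mu> = market_weights S"
    and covariations: "has_covariations T \<pi> \<mu>"
    and A_CBV: "CBV T A"
    and G_pos: "\<And>z. 0 < G z"
    and G_regular: "regular_for T \<pi> G \<mu> A"
    and G_normalized: "G (\<mu> 0, A 0) = 1"
    and F_bounds: "\<And>t. t \<in> {0..T} \<Longrightarrow> F (\<mu> t, A t) \<le> G (\<mu> t, A t) \<and> 0 < F (\<mu> t, A t)"
    and F_mono: "mono_on {0..T} (\<lambda>t. F (\<mu> t, A t))"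
    and Gam_antimono: "antimono_on {0..T} (Gam \<pi> G \<mu> A)"
    and \<kappa>_pos: "0 < \<kappa>"
    and Gam_lower: "\<And>t. t \<in> {0..T} \<Longrightarrow> - \<kappa> \<le> Gam \<pi> G \<mu> A t"
    and T_star: "T_star \<in> {0<..T}"
    and threshold: "ln (F (\<mu> T_star, A T_star)) > \<kappa> / F (\<mu> 0, A 0)"
  shows "\<forall>t\<in>{T_star..T}. strong_arbitrage (mult_generated \<pi> G \<mu> A) \<mu> t"
proof
  fix t assume t: "t \<in> {T_star..T}"
  interpret regular_path T \<pi> \<mu> A G
    using T_pos partitions covariations A_CBV G_regular market_weights_path[OF prices]
    by unfold_locales (auto simp: weights regular_for_def)
  define L where "L = log_factor"
  have value_eq: "portfolio_value (mult_generated \<pi> G \<mu> A) \<mu> s = g s * exp (L s)" if "s \<in> {0..T}" for s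
    unfolding L_def using market_weights_path(2)[OF prices] that
    by (intro portfolio_value_mult_generated G_pos Gam_antimono) (auto simp: weights)
  have F0: "0 < F (\<mu> 0, A 0)" and t': "0 < t" "t \<in> {0..T}"
    using F_bounds[of 0] T_pos T_star t by auto
  \<comment> \<open>Along the path \<open>G\<close> dominates the nondecreasing \<open>F\<close>, so
    its values stay above the initial value of \<open>F\<close>; this gives the constant for
    \<open>log_factor_bounds\<close>.\<close>
  have inverse_g: "1 / g x \<le> 1 / F (\<mu> 0, A 0)" if "x \<in> {0..T}" for x
  proof (rule divide_left_mono)
    have "F (\<mu> 0, A 0) \<le> F (\<mu> x, A x)"
      by (rule mono_onD[OF F_mono]) (use that in auto)
    then show "F (\<mu> 0, A 0) \<le> g x" using F_bounds[OF that] by simp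
  qed (use F0 G_pos in auto)
  \<comment> \<open>The sums of \<open>defect\<close> stopped at 0 vanish identically, hence so does
    their limit.\<close>
  have Gam_0: "Gam \<pi> G \<mu> A 0 = 0"
    using Gam_limit(2)[of 0] T_pos partition_sum_0[OF part, of defect]
    by (simp add: LIMSEQ_const_iff)
  have L_0: "L 0 = 0"
    unfolding L_def by (rule log_factor_0[OF G_pos Gam_antimono])
  have "1 / F (\<mu> 0, A 0) * (Gam \<pi> G \<mu> A t - Gam \<pi> G \<mu> A 0) \<le> L t - L 0"
    unfolding L_def
    by (rule log_factor_bounds(1)[OF G_pos Gam_antimono inverse_g]) (use t' in auto)
  moreover have "1 / F (\<mu> 0, A 0) * (- \<kappa>) \<le> 1 / F (\<mu> 0, A 0) * Gam \<pi> G \<mu> A t"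
    using Gam_lower[OF t'(2)] F0 by (intro mult_left_mono) auto
  ultimately have L_t: "- (\<kappa> / F (\<mu> 0, A 0)) \<le> L t" by (simp add: Gam_0 L_0)
  \<comment> \<open>Monotonicity carries the threshold from \<open>T_star\<close> to every later
    \<open>t\<close>.\<close>
  have "F (\<mu> T_star, A T_star) \<le> F (\<mu> t, A t)"
    by (rule mono_onD[OF F_mono]) (use t T_star in auto)
  then have g_t: "F (\<mu> T_star, A T_star) \<le> g t" using F_bounds[OF t'(2)] by simp
  have "0 < F (\<mu> T_star, A T_star)" using F_bounds[of T_star] T_star by simp
  then have "ln (F (\<mu> T_star, A T_star)) \<le> ln (g t)" using g_t by (intro ln_mono) auto
  then have "0 < ln (g t) + L t" using threshold L_t by linarith
  then have "1 < exp (ln (g t) + L t)" by simp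
  then have "1 < g t * exp (L t)" using G_pos by (simp add: exp_add)
  \<comment> \<open>The value \<open>g s * exp (L s)\<close> is positive at all times and equals 1
    at time 0 by the normalization.\<close>
  then show "strong_arbitrage (mult_generated \<pi> G \<mu> A) \<mu> t"
    using value_eq t' G_pos T_pos unfolding strong_arbitrage_def
    by (auto simp: L_0 G_normalized less_imp_le)
qed

end
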